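(* Suppose $\Gamma$ is (isomorphic as a topological group to) the automorphism group of a countable ultrahomogeneous structure in a finite relational language. Then $\Gamma$ is graphic.
   Context: A structure $M$ is ultrahomogeneous if every isomorphism between finite substructures of $M$ extends to an automorphism of $M$; its automorphism group carries the pointwise convergence topology. A Polish group $\Gamma$ is graphic if for every Borel action of $\Gamma$ on a Polish space $X$, the orbit equivalence relation equals the connectedness relation of some Borel graph on $X$. *)

theory Defs
  imports "HOL-Analysis.Analysis" "HOL-Algebra.Group_Action"
begin

definition polish_space :: "'a topology \<Rightarrow> bool" where
  "polish_space X \<longleftrightarrow> completely_metrizable_space X \<and> separable_space X"

definition borel_of :: "'a topology \<Rightarrow> 'a measure" where
  "borel_of X = sigma (topspace X) {U. openin X U}"

definition topological_group :: "('g, 'm) monoid_scheme \<Rightarrow> 'g topology \<Rightarrow> bool" where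
  "topological_group \<Gamma> T \<longleftrightarrow>
     group \<Gamma> \<and> topspace T = carrier \<Gamma> \<and>
     continuous_map (prod_topology T T) T (\<lambda>(g, h). g \<otimes>\<^bsub>\<Gamma>\<^esub> h) \<and>
     continuous_map T T (\<lambda>g. inv\<^bsub>\<Gamma>\<^esub> g)"

definition polish_group :: "('g, 'm) monoid_scheme \<Rightarrow> 'g topology \<Rightarrow> bool" where
  "polish_group \<Gamma> T \<longleftrightarrow> topological_group \<Gamma> T \<and> polish_space T"

definition topological_group_isomorphic ::
  "('g, 'm) monoid_scheme \<Rightarrow> 'g topology \<Rightarrow> ('h, 'n) monoid_scheme \<Rightarrow> 'h topology \<Rightarrow> bool" where
  "topological_group_isomorphic \<Gamma> T \<Delta> S \<longleftrightarrow>
     (\<exists>\<psi>. \<psi> \<in> iso \<Gamma> \<Delta> \<and> homeomorphic_map T S \<psi>)"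

definition borel_action ::
  "('g, 'm) monoid_scheme \<Rightarrow> 'g topology \<Rightarrow> 'x topology \<Rightarrow> ('g \<Rightarrow> 'x \<Rightarrow> 'x) \<Rightarrow> bool" where
  "borel_action \<Gamma> T X \<phi> \<longleftrightarrow>
     group_action \<Gamma> (topspace X) \<phi> \<and>
     (\<lambda>(g, x). \<phi> g x) \<in> borel_of (prod_topology T X) \<rightarrow>\<^sub>M borel_of X"

definition orbit_equivalence_relation ::
  "('g, 'm) monoid_scheme \<Rightarrow> 'x topology \<Rightarrow> ('g \<Rightarrow> 'x \<Rightarrow> 'x) \<Rightarrow> ('x \<times> 'x) set" where
  "orbit_equivalence_relation \<Gamma> X \<phi> = {(x, y). x \<in> topspace X \<and> y \<in> orbit \<Gamma> \<phi> x}"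

definition borel_graph :: "'x topology \<Rightarrow> ('x \<times> 'x) set \<Rightarrow> bool" where
  "borel_graph X G \<longleftrightarrow> G \<in> sets (borel_of (prod_topology X X)) \<and> sym G \<and> irrefl G"

definition connectedness_relation :: "'x topology \<Rightarrow> ('x \<times> 'x) set \<Rightarrow> ('x \<times> 'x) set" where
  "connectedness_relation X G = {(x, y). x \<in> topspace X \<and> y \<in> topspace X \<and> (x, y) \<in> G\<^sup>*}"

text \<open>
  A definition cannot quantify over all types, so the type containing the points of the Polish
  space is a parameter. Being graphic means that this holds for every type \<open>'x\<close>.
\<close>

definition graphic :: "'x itself \<Rightarrow> ('g, 'm) monoid_scheme \<Rightarrow> 'g topology \<Rightarrow> bool" where
  "graphic tx \<Gamma> T \<longleftrightarrow>
     polish_group \<Gamma> T \<and>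
     (\<forall>(X :: 'x topology) \<phi>. polish_space X \<and> borel_action \<Gamma> T X \<phi> \<longrightarrow>
        (\<exists>G. borel_graph X G \<and>
             orbit_equivalence_relation \<Gamma> X \<phi> = connectedness_relation X G))"

record 'r rel_language =
  symbols :: "'r set"
  arity :: "'r \<Rightarrow> nat"

record ('r, 'a) rel_structure =
  universe :: "'a set"
  interp :: "'r \<Rightarrow> 'a list set"

definition is_structure :: "'r rel_language \<Rightarrow> ('r, 'a) rel_structure \<Rightarrow> bool" where
  "is_structure L M \<longleftrightarrow>
     (\<forall>r \<in> symbols L. interp M r \<subseteq> {xs \<in> lists (universe M). length xs = arity L r})"

text \<open>In a relational language every subset of the universe carries a substructure.\<close>

definition substructure :: "('r, 'a) rel_structure \<Rightarrow> 'a set \<Rightarrow> ('r, 'a) rel_structure" where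
  "substructure M A = \<lparr>universe = A, interp = (\<lambda>r. interp M r \<inter> lists A)\<rparr>"

definition structure_iso ::
  "'r rel_language \<Rightarrow> ('r, 'a) rel_structure \<Rightarrow> ('r, 'b) rel_structure \<Rightarrow> ('a \<Rightarrow> 'b) set" where
  "structure_iso L M N =
     {f. bij_betw f (universe M) (universe N) \<and>
         (\<forall>r \<in> symbols L. \<forall>xs \<in> lists (universe M). length xs = arity L r \<longrightarrow>
            (xs \<in> interp M r \<longleftrightarrow> map f xs \<in> interp N r))}"

text \<open>Automorphisms are extensional outside the universe, as in \<open>BijGroup\<close>.\<close>

definition automorphisms :: "'r rel_language \<Rightarrow> ('r, 'a) rel_structure \<Rightarrow> ('a \<Rightarrow> 'a) set" where
  "automorphisms L M = structure_iso L M M \<inter> Bij (universe M)"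

definition Aut_group :: "'r rel_language \<Rightarrow> ('r, 'a) rel_structure \<Rightarrow> ('a \<Rightarrow> 'a) monoid" where
  "Aut_group L M = BijGroup (universe M) \<lparr>carrier := automorphisms L M\<rparr>"

definition Aut_topology :: "'r rel_language \<Rightarrow> ('r, 'a) rel_structure \<Rightarrow> ('a \<Rightarrow> 'a) topology" where
  "Aut_topology L M =
     subtopology (product_topology (\<lambda>_. discrete_topology (universe M)) (universe M))
       (automorphisms L M)"

definition ultrahomogeneous :: "'r rel_language \<Rightarrow> ('r, 'a) rel_structure \<Rightarrow> bool" where
  "ultrahomogeneous L M \<longleftrightarrow>
     (\<forall>A B f. finite A \<and> A \<subseteq> universe M \<and> finite B \<and> B \<subseteq> universe M \<and>
        f \<in> structure_iso L (substructure M A) (substructure M B) \<longrightarrow>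
        (\<exists>g \<in> automorphisms L M. \<forall>a \<in> A. g a = f a))"

end

theory Submission
  imports Defs
begin

text \<open>
  Let \<open>A\<close> be the automorphism group acting on the Polish space \<open>X\<close>. Points with an open stabilizer
  have countable orbits, and these are connected by the graphs of the elements of a countable dense
  subset of \<open>A\<close>. For any other point \<open>x\<close> and any \<open>h \<in> A\<close> there is a \<open>g \<in> A\<close> such that \<open>y = g x\<close>
  codes both \<open>g\<close> and \<open>g h\<inverse>\<close>, so that \<open>x\<close> and \<open>h x\<close> are both adjacent to \<open>y\<close> in the Borel graph
  that joins \<open>z\<close> to \<open>y\<close> if one of the two elements decoded from \<open>y\<close> moves \<open>z\<close> to \<open>y\<close>.

  The Vaught transforms of basic open sets turn \<open>y\<close> into a structure on the universe, and
  equivariantly so. Coding and decoding maintain a finite set \<open>R\<close> of elements of the universe.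
  The next bit of \<open>y\<close> is the truth value of the first atomic fact that is not constant on the orbit
  of \<open>y\<close> under the pointwise stabilizer of \<open>R\<close>; its parameters are then added to \<open>R\<close>. The choice of
  this fact depends on that orbit only, hence it is the same for the coder and the decoder, whichever
  of \<open>x\<close> and \<open>h x\<close> one starts from. For the approximations of \<open>g\<close> to converge to a surjective map,
  every element of the universe must eventually be moved into \<open>R\<close>. This works without additional
  information for the decoder, because the stabilizer of \<open>R\<close> has finitely many orbits, whose
  representatives can all be added to \<open>R\<close>: here ultrahomogeneity and finiteness of the language enter.
\<close>

section \<open>Polish spaces and their Borel sets\<close>

lemma polish_space_imp_second_countable:
  assumes "polish_space X"
  shows "second_countable X"
proof -
  obtain M d where Md: "Metric_space M d" and X: "X = Metric_space.mtopology M d"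
    using assms unfolding polish_space_def completely_metrizable_space_def by blast
  interpret Metric_space M d by (fact Md)
  obtain D where D: "countable D" "D \<subseteq> topspace X" "X closure_of D = topspace X"
    using assms unfolding polish_space_def separable_space_def by blast
  define \<B> where "\<B> = (\<lambda>(c, n). mball c (inverse (real (Suc n)))) ` (D \<times> (UNIV :: nat set))"
  have "countable \<B>"
    unfolding \<B>_def using D(1) by (intro countable_image countable_SIGMA) auto
  moreover have "openin X V" if "V \<in> \<B>" for V
    using that by (auto simp: \<B>_def X)
  moreover have "\<exists>V\<in>\<B>. x \<in> V \<and> V \<subseteq> U" if U: "openin X U" "x \<in> U" for U x
  proof -
    obtain r where r: "r > 0" "mball x r \<subseteq> U"
      using U X openin_mtopology by blast
    have xM: "x \<in> M"
      using U X openin_mtopology by blast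
    \<comment> \<open>Half of \<open>r\<close>, because the distance from \<open>x\<close> to a
      point of the small ball is estimated through the centre \<open>c\<close>.\<close>
    obtain n where n: "inverse (real (Suc n)) < r / 2"
      using reals_Archimedean[of "r / 2"] r(1) by auto
    have "x \<in> X closure_of D"
      using xM D(3) X by simp
    then have "\<forall>r>0. \<exists>c\<in>D. c \<in> mball x r"
      using X by (simp add: metric_closure_of)
    then obtain c where c: "c \<in> D" "c \<in> mball x (inverse (real (Suc n)))"
      by (meson inverse_positive_iff_positive of_nat_0_less_iff zero_less_Suc)
    have "x \<in> mball c (inverse (real (Suc n)))"
      using c xM by (simp add: commute)
    moreover have "mball c (inverse (real (Suc n))) \<subseteq> mball x r"
    proof
      fix z assume z: "z \<in> mball c (inverse (real (Suc n)))"
      have "d x z \<le> d x c + d c z"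
        using triangle xM z c by auto
      also have "\<dots> < r"
        using z c n by simp
      finally show "z \<in> mball x r" using z xM by simp
    qed
    ultimately show ?thesis
      using c(1) r(2) by (intro bexI[of _ "mball c (inverse (real (Suc n)))"]) (auto simp: \<B>_def)
  qed
  ultimately show ?thesis unfolding second_countable_def by blast
qed

lemma polish_space_imp_Hausdorff_space: "polish_space X \<Longrightarrow> Hausdorff_space X"
  by (simp add: polish_space_def completely_metrizable_imp_metrizable_space
      metrizable_imp_Hausdorff_space)

lemma space_borel_of [simp]: "space (borel_of X) = topspace X"
  unfolding borel_of_def by (rule space_measure_of) (auto dest: openin_subset)

lemma sets_borel_of: "sets (borel_of X) = sigma_sets (topspace X) {U. openin X U}"
  unfolding borel_of_def by (rule sets_measure_of) (auto dest: openin_subset)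

lemma openin_borel_of: "openin X U \<Longrightarrow> U \<in> sets (borel_of X)"
  by (auto simp: sets_borel_of)

lemma closedin_borel_of: "closedin X C \<Longrightarrow> C \<in> sets (borel_of X)"
proof -
  assume C: "closedin X C"
  then have "space (borel_of X) - (topspace X - C) \<in> sets (borel_of X)"
    by (intro sets.compl_sets openin_borel_of) (simp add: closedin_def)
  moreover have "space (borel_of X) - (topspace X - C) = C"
    using closedin_subset[OF C] by auto
  ultimately show ?thesis by simp
qed

lemma measurable_borel_ofI:
  assumes "\<And>x. x \<in> space N \<Longrightarrow> f x \<in> topspace X"
    and "\<And>U. openin X U \<Longrightarrow> f -` U \<inter> space N \<in> sets N"
  shows "f \<in> N \<rightarrow>\<^sub>M borel_of X"
  unfolding borel_of_def
  by (rule measurable_measure_of) (use assms in \<open>auto dest: openin_subset\<close>)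

lemma continuous_map_measurable:
  assumes "continuous_map X Y f"
  shows "f \<in> borel_of X \<rightarrow>\<^sub>M borel_of Y"
proof (rule measurable_borel_ofI)
  fix U assume "openin Y U"
  then have "openin X {x \<in> topspace X. f x \<in> U}"
    using assms by (simp add: openin_continuous_map_preimage)
  moreover have "{x \<in> topspace X. f x \<in> U} = f -` U \<inter> space (borel_of X)" by auto
  ultimately show "f -` U \<inter> space (borel_of X) \<in> sets (borel_of X)"
    by (metis openin_borel_of)
qed (use assms in \<open>simp add: continuous_map_def Pi_iff\<close>)

text \<open>Every open subset of the product is a union of rectangles from one fixed countable
  family. This makes pairing Borel measurable and gives the base case of
  \<open>nonmeager_section_borel_of\<close>.\<close>

lemma second_countable_prod_open_UN:
  assumes "second_countable X" "second_countable Y"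
  obtains \<R> where "countable \<R>"
    "\<And>p. p \<in> \<R> \<Longrightarrow> openin X (fst p) \<and> openin Y (snd p)"
    "\<And>Q. openin (prod_topology X Y) Q \<Longrightarrow> Q = (\<Union>p\<in>{p \<in> \<R>. fst p \<times> snd p \<subseteq> Q}. fst p \<times> snd p)"
proof -
  obtain \<B> where \<B>: "countable \<B>" "\<forall>V\<in>\<B>. openin X V"
    "\<forall>U x. openin X U \<and> x \<in> U \<longrightarrow> (\<exists>V\<in>\<B>. x \<in> V \<and> V \<subseteq> U)"
    using assms(1) unfolding second_countable_def by blast
  obtain \<C> where \<C>: "countable \<C>" "\<forall>V\<in>\<C>. openin Y V"
    "\<forall>U x. openin Y U \<and> x \<in> U \<longrightarrow> (\<exists>V\<in>\<C>. x \<in> V \<and> V \<subseteq> U)"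
    using assms(2) unfolding second_countable_def by blast
  show thesis
  proof (rule that[of "\<B> \<times> \<C>"])
    fix Q assume Q: "openin (prod_topology X Y) Q"
    have "\<exists>p. p \<in> \<B> \<times> \<C> \<and> fst p \<times> snd p \<subseteq> Q \<and> (x, y) \<in> fst p \<times> snd p"
      if xy: "(x, y) \<in> Q" for x y
    proof -
      obtain U U' where UU': "openin X U" "openin Y U'" "x \<in> U" "y \<in> U'" "U \<times> U' \<subseteq> Q"
        using Q xy unfolding openin_prod_topology_alt by meson
      obtain V where "V \<in> \<B>" "x \<in> V" "V \<subseteq> U" using \<B>(3) UU' by meson
      moreover obtain W where "W \<in> \<C>" "y \<in> W" "W \<subseteq> U'" using \<C>(3) UU' by meson
      ultimately show ?thesis using UU'(5) by (intro exI[of _ "(V, W)"]) auto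
    qed
    then show "Q = (\<Union>p\<in>{p \<in> \<B> \<times> \<C>. fst p \<times> snd p \<subseteq> Q}. fst p \<times> snd p)"
      by fast
  qed (use \<B> \<C> in auto)
qed

lemma measurable_Pair_borel_of:
  assumes X: "second_countable X" and Y: "second_countable Y"
    and f: "f \<in> N \<rightarrow>\<^sub>M borel_of X" and g: "g \<in> N \<rightarrow>\<^sub>M borel_of Y"
  shows "(\<lambda>x. (f x, g x)) \<in> N \<rightarrow>\<^sub>M borel_of (prod_topology X Y)"
proof (rule measurable_borel_ofI)
  fix x assume "x \<in> space N"
  then show "(f x, g x) \<in> topspace (prod_topology X Y)"
    using measurable_space[OF f] measurable_space[OF g] by simp
next
  fix Q assume Q: "openin (prod_topology X Y) Q"
  obtain \<R> where \<R>: "countable \<R>"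
    "\<And>p. p \<in> \<R> \<Longrightarrow> openin X (fst p) \<and> openin Y (snd p)"
    "\<And>Q. openin (prod_topology X Y) Q \<Longrightarrow> Q = (\<Union>p\<in>{p \<in> \<R>. fst p \<times> snd p \<subseteq> Q}. fst p \<times> snd p)"
    by (rule second_countable_prod_open_UN[OF X Y]) (rule that)
  define I where "I = {p \<in> \<R>. fst p \<times> snd p \<subseteq> Q}"
  have Qeq: "Q = (\<Union>p\<in>I. fst p \<times> snd p)"
    unfolding I_def by (rule \<R>(3)[OF Q])
  have "(\<lambda>x. (f x, g x)) -` Q \<inter> space N =
      (\<Union>p\<in>I. (f -` fst p \<inter> space N) \<inter> (g -` snd p \<inter> space N))"
    by (subst Qeq) auto
  also have "\<dots> \<in> sets N"
  proof (rule sets.countable_UN'')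
    show "countable I"
      unfolding I_def by (rule countable_subset[OF _ \<R>(1)]) auto
    fix p assume "p \<in> I"
    then have "fst p \<in> sets (borel_of X)" "snd p \<in> sets (borel_of Y)"
      using \<R>(2)[of p] by (simp_all add: I_def openin_borel_of)
    then show "(f -` fst p \<inter> space N) \<inter> (g -` snd p \<inter> space N) \<in> sets N"
      using measurable_sets[OF f] measurable_sets[OF g] by auto
  qed
  finally show "(\<lambda>x. (f x, g x)) -` Q \<inter> space N \<in> sets N" .
qed

text \<open>The set is the preimage of the diagonal under the pairing of \<open>f\<close> and
  \<open>g\<close>, and the diagonal of a Hausdorff space is closed.\<close>

lemma sets_Collect_eq_borel_of:
  assumes X: "second_countable X" "Hausdorff_space X"
    and f: "f \<in> N \<rightarrow>\<^sub>M borel_of X" and g: "g \<in> N \<rightarrow>\<^sub>M borel_of X"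
  shows "{x \<in> space N. f x = g x} \<in> sets N"
proof -
  let ?D = "(\<lambda>x. (x, x)) ` topspace X"
  have "closedin (prod_topology X X) ?D"
    using X(2) by (simp add: Hausdorff_space_closedin_diagonal)
  then have "(\<lambda>x. (f x, g x)) -` ?D \<inter> space N \<in> sets N"
    by (intro measurable_sets[OF measurable_Pair_borel_of[OF X(1) X(1) f g]] closedin_borel_of)
  moreover have "(\<lambda>x. (f x, g x)) -` ?D \<inter> space N = {x \<in> space N. f x = g x}"
    using measurable_space[OF f] by (auto simp: image_iff) (metis space_borel_of)
  ultimately show ?thesis by simp
qed

lemma pred_countable_Bex:
  assumes "countable I" "\<And>i. i \<in> I \<Longrightarrow> Measurable.pred N (P i)"
  shows "Measurable.pred N (\<lambda>x. \<exists>i\<in>I. P i x)"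
proof -
  have "{x \<in> space N. \<exists>i\<in>I. P i x} = (\<Union>i\<in>I. {x \<in> space N. P i x})" by auto
  also have "\<dots> \<in> sets N"
    using assms by (intro sets.countable_UN'') (auto simp: pred_def)
  finally show ?thesis by (simp add: pred_def)
qed

lemma pred_countable_Ball:
  assumes "countable I" "\<And>i. i \<in> I \<Longrightarrow> Measurable.pred N (P i)"
  shows "Measurable.pred N (\<lambda>x. \<forall>i\<in>I. P i x)"
proof -
  have "Measurable.pred N (\<lambda>x. \<not> (\<exists>i\<in>I. \<not> P i x))"
    using assms by (intro pred_intros_logic pred_countable_Bex)
  then show ?thesis by simp
qed

subsection \<open>Meager sets\<close>

text \<open>For subsets of the space this means being covered by countably many nowhere dense sets.
  The complementary dense open sets are used because Baire's theorem speaks of them.\<close>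

definition meager_in :: "'a topology \<Rightarrow> 'a set \<Rightarrow> bool" where
  "meager_in T S \<longleftrightarrow>
     (\<exists>\<G>. countable \<G> \<and> (\<forall>G\<in>\<G>. openin T G \<and> T closure_of G = topspace T) \<and> S \<inter> \<Inter>\<G> = {})"

lemma meager_in_subset: "meager_in T S \<Longrightarrow> S' \<subseteq> S \<Longrightarrow> meager_in T S'"
  unfolding meager_in_def by (elim exE conjE, intro exI conjI) auto

lemma meager_in_empty [simp]: "meager_in T {}"
  unfolding meager_in_def by (rule exI[of _ "{}"]) auto

lemma meager_in_UN:
  assumes "countable I" "\<And>i. i \<in> I \<Longrightarrow> meager_in T (S i)"
  shows "meager_in T (\<Union>i\<in>I. S i)"
proof -
  obtain \<G> where \<G>: "\<And>i. i \<in> I \<Longrightarrow> countable (\<G> i) \<and>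
      (\<forall>G\<in>\<G> i. openin T G \<and> T closure_of G = topspace T) \<and> S i \<inter> \<Inter>(\<G> i) = {}"
    using assms(2) unfolding meager_in_def by metis
  have "countable (\<Union>i\<in>I. \<G> i)" using assms(1) \<G> by auto
  moreover have "(\<Union>i\<in>I. S i) \<inter> \<Inter>(\<Union>i\<in>I. \<G> i) = {}"
  proof -
    have "x \<notin> \<Inter>(\<Union>i\<in>I. \<G> i)" if "i \<in> I" "x \<in> S i" for x i
      using \<G>[OF that(1)] that by (metis Int_iff UN_I Inter_iff empty_iff)
    then show ?thesis by blast
  qed
  ultimately show ?thesis unfolding meager_in_def using \<G>
    by (intro exI[of _ "\<Union>i\<in>I. \<G> i"]) auto
qed

lemma meager_in_Un: "meager_in T S \<Longrightarrow> meager_in T S' \<Longrightarrow> meager_in T (S \<union> S')"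
  using meager_in_UN[of "{S, S'}" T "\<lambda>S. S"] by auto

text \<open>By Baire's theorem the intersection of the dense open sets is dense and so meets
  \<open>U\<close>.\<close>

lemma openin_not_meager_in:
  assumes "completely_metrizable_space T" "openin T U" "U \<noteq> {}"
  shows "\<not> meager_in T U"
proof
  assume "meager_in T U"
  then obtain \<G> where \<G>: "countable \<G>" "\<forall>G\<in>\<G>. openin T G \<and> T closure_of G = topspace T"
      "U \<inter> \<Inter>\<G> = {}"
    unfolding meager_in_def by blast
  have "T closure_of (\<Inter>\<G>) = topspace T"
    using assms(1) \<G> by (intro Baire_category) auto
  then show False
    using \<G>(3) assms(2,3) by (simp add: dense_intersects_open Int_commute)
qed

text \<open>A homeomorphism carries dense open sets to dense open sets, and injectivity keeps the
  image of \<open>S\<close> off their intersection. \<open>Y_act_imp\<close> applies this to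
  translations.\<close>

lemma homeomorphic_map_meager_in:
  assumes \<rho>: "homeomorphic_map T T' \<rho>" and "S \<subseteq> topspace T" "meager_in T S"
  shows "meager_in T' (\<rho> ` S)"
proof -
  obtain \<G> where \<G>: "countable \<G>" "\<forall>G\<in>\<G>. openin T G \<and> T closure_of G = topspace T"
      "S \<inter> \<Inter>\<G> = {}"
    using assms(3) unfolding meager_in_def by blast
  have inj: "inj_on \<rho> (topspace T)" using \<rho> by (simp add: homeomorphic_map_def)
  have "countable ((`) \<rho> ` \<G>)" using \<G> by simp
  moreover have "openin T' G \<and> T' closure_of G = topspace T'" if G: "G \<in> (`) \<rho> ` \<G>" for G
  proof -
    obtain H where H: "G = \<rho> ` H" "openin T H" "T closure_of H = topspace T"
      using G \<G>(2) by auto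
    have "openin T' G"
      using H \<rho> by (metis homeomorphic_map_openness openin_subset)
    moreover have "T' closure_of G = \<rho> ` (T closure_of H)"
      using H \<rho> homeomorphic_map_closure_of openin_subset by metis
    ultimately show ?thesis using H(3) \<rho> by (simp add: homeomorphic_imp_surjective_map)
  qed
  moreover have "\<rho> ` S \<inter> \<Inter>((`) \<rho> ` \<G>) = {}"
  proof (rule ccontr)
    assume "\<rho> ` S \<inter> \<Inter>((`) \<rho> ` \<G>) \<noteq> {}"
    then obtain s where s: "s \<in> S" "\<forall>G\<in>\<G>. \<rho> s \<in> \<rho> ` G" by auto
    have "s \<in> G" if G: "G \<in> \<G>" for G
    proof -
      obtain t where "t \<in> G" "\<rho> s = \<rho> t" using s G by auto
      moreover have "t \<in> topspace T" using \<G> G \<open>t \<in> G\<close> openin_subset by blast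
      ultimately show ?thesis using inj s(1) assms(2) by (metis inj_onD subsetD)
    qed
    then show False using \<G>(3) s(1) by auto
  qed
  ultimately show ?thesis unfolding meager_in_def
    by (intro exI[of _ "(`) \<rho> ` \<G>"]) auto
qed

text \<open>In a second countable space this is equivalent to the Baire property.\<close>

definition almost_open :: "'a topology \<Rightarrow> 'a set \<Rightarrow> bool" where
  "almost_open T S \<longleftrightarrow>
     (\<forall>U. openin T U \<and> U \<noteq> {} \<longrightarrow>
        (\<exists>V. openin T V \<and> V \<noteq> {} \<and> V \<subseteq> U \<and> (meager_in T (V \<inter> S) \<or> meager_in T (V - S))))"

text \<open>Otherwise the open sets in which \<open>S\<close> is meager are dense in
  \<open>U\<close>. Countably many basic ones among them, together with the exterior of
  \<open>U\<close>, form a dense open set \<open>D\<close>. Then \<open>U \<inter> S\<close> is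
  meager: outside \<open>D\<close> because \<open>D\<close> is dense and open, inside
  \<open>D\<close> as a countable union of meager sets.\<close>

lemma almost_open_nonmeagerD:
  assumes T: "second_countable T" and S: "almost_open T S" and U: "openin T U"
    and nm: "\<not> meager_in T (U \<inter> S)"
  shows "\<exists>V. openin T V \<and> V \<noteq> {} \<and> V \<subseteq> U \<and> meager_in T (V - S)"
proof (rule ccontr)
  assume neg: "\<not> ?thesis"
  obtain \<B> where \<B>: "countable \<B>" "\<forall>V\<in>\<B>. openin T V"
    "\<forall>U x. openin T U \<and> x \<in> U \<longrightarrow> (\<exists>V\<in>\<B>. x \<in> V \<and> V \<subseteq> U)"
    using T unfolding second_countable_def by blast
  define \<V> where "\<V> = {V \<in> \<B>. V \<subseteq> U \<and> meager_in T (V \<inter> S)}"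
  define D where "D = \<Union>\<V> \<union> (topspace T - T closure_of U)"
  have D: "openin T D"
    unfolding D_def \<V>_def using \<B>(2) by (intro openin_Un openin_Union) auto
  have "D \<inter> Q \<noteq> {}" if Q: "openin T Q" "Q \<noteq> {}" for Q
  proof (cases "Q \<inter> U = {}")
    case True
    then have "Q \<inter> T closure_of U = {}"
      using Q(1) openin_Int_closure_of_eq_empty by metis
    then show ?thesis using Q openin_subset[OF Q(1)] by (auto simp: D_def)
  next
    case False
    then obtain V where V: "openin T V" "V \<noteq> {}" "V \<subseteq> Q \<inter> U"
        "meager_in T (V \<inter> S) \<or> meager_in T (V - S)"
      using S Q(1) U unfolding almost_open_def by (meson openin_Int)
    then have m: "meager_in T (V \<inter> S)" using neg by blast
    obtain x where "x \<in> V" using V by auto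
    then obtain W where W: "W \<in> \<B>" "x \<in> W" "W \<subseteq> V" using \<B>(3) V(1) by meson
    then have "W \<in> \<V>" using V(3) m by (auto simp: \<V>_def elim: meager_in_subset)
    then show ?thesis using W V(3) unfolding D_def by blast
  qed
  then have "T closure_of D = topspace T"
    by (simp add: dense_intersects_open)
  then have "meager_in T (U \<inter> S - D)"
    unfolding meager_in_def using D by (intro exI[of _ "{D}"]) auto
  moreover have "meager_in T (\<Union>V\<in>\<V>. V \<inter> S)"
    by (rule meager_in_UN) (use \<B>(1) in \<open>auto simp: \<V>_def\<close>)
  ultimately have "meager_in T ((U \<inter> S - D) \<union> (\<Union>V\<in>\<V>. V \<inter> S))"
    by (rule meager_in_Un)
  moreover have "U \<inter> S \<subseteq> (U \<inter> S - D) \<union> (\<Union>V\<in>\<V>. V \<inter> S)"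
    using closure_of_subset[OF openin_subset[OF U]] by (auto simp: D_def)
  ultimately show False using nm meager_in_subset by blast
qed

text \<open>Complements exchange the two alternatives of \<open>almost_open\<close>. For a countable
  union, either every member is meager in \<open>U\<close>, or some member is comeager in a smaller
  open set, and then so is the union.\<close>

lemma borel_of_almost_open:
  assumes T: "second_countable T" and S: "S \<in> sets (borel_of T)"
  shows "almost_open T S"
  using S unfolding sets_borel_of
proof (induction rule: sigma_sets.induct)
  case (Basic S)
  then have S: "openin T S" by simp
  show ?case unfolding almost_open_def
  proof (intro allI impI, elim conjE)
    fix U assume U: "openin T U" "U \<noteq> {}"
    show "\<exists>V. openin T V \<and> V \<noteq> {} \<and> V \<subseteq> U \<and> (meager_in T (V \<inter> S) \<or> meager_in T (V - S))"
    proof (cases "U \<inter> S = {}")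
      case True then show ?thesis using U by auto
    next
      case False
      then show ?thesis using U S by (intro exI[of _ "U \<inter> S"]) (auto simp: Diff_eq Int_assoc)
    qed
  qed
next
  case Empty then show ?case unfolding almost_open_def by auto
next
  case (Compl S)
  have "V \<inter> (topspace T - S) = V - S \<and> V - (topspace T - S) = V \<inter> S" if "openin T V" for V
    using openin_subset[OF that] by auto
  then show ?case using Compl.IH unfolding almost_open_def by metis
next
  case (Union S)
  show ?case unfolding almost_open_def
  proof (intro allI impI, elim conjE)
    fix U assume U: "openin T U" "U \<noteq> {}"
    show "\<exists>V. openin T V \<and> V \<noteq> {} \<and> V \<subseteq> U \<and>
        (meager_in T (V \<inter> (\<Union>i. S i)) \<or> meager_in T (V - (\<Union>i. S i)))"
    proof (cases "\<forall>i. meager_in T (U \<inter> S i)")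
      case True
      then have "meager_in T (U \<inter> (\<Union>i. S i))"
        using meager_in_UN[of UNIV T "\<lambda>i. U \<inter> S i"] by simp
      then show ?thesis using U by blast
    next
      case False
      then obtain i V where "openin T V" "V \<noteq> {}" "V \<subseteq> U" "meager_in T (V - S i)"
        using almost_open_nonmeagerD[OF T Union.IH U(1)] by blast
      moreover from this have "meager_in T (V - (\<Union>i. S i))"
        by (elim meager_in_subset) auto
      ultimately show ?thesis by blast
    qed
  qed
qed

lemma section_borel_of:
  assumes "B \<in> sets (borel_of (prod_topology T X))" "x \<in> topspace X"
  shows "{f \<in> topspace T. (f, x) \<in> B} \<in> sets (borel_of T)"
proof -
  have "continuous_map T (prod_topology T X) (\<lambda>f. (f, x))"
    using assms(2) by (simp add: continuous_map_pairwise o_def)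
  from measurable_sets[OF continuous_map_measurable[OF this] assms(1)]
  have "(\<lambda>f. (f, x)) -` B \<inter> space (borel_of T) \<in> sets (borel_of T)" .
  moreover have "(\<lambda>f. (f, x)) -` B \<inter> space (borel_of T) = {f \<in> topspace T. (f, x) \<in> B}" by auto
  ultimately show ?thesis by simp
qed

text \<open>Meager sets form a sigma-ideal, so the category quantifier commutes with countable
  unions.\<close>

lemma nonmeager_section_UN:
  assumes "countable I"
  shows "{x \<in> A. \<not> meager_in T {f \<in> U. (f, x) \<in> (\<Union>i\<in>I. S i)}} =
    (\<Union>i\<in>I. {x \<in> A. \<not> meager_in T {f \<in> U. (f, x) \<in> S i}})"
proof -
  have "{f \<in> U. (f, x) \<in> (\<Union>i\<in>I. S i)} = (\<Union>i\<in>I. {f \<in> U. (f, x) \<in> S i})" for x by auto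
  moreover have "meager_in T (\<Union>i\<in>I. {f \<in> U. (f, x) \<in> S i}) \<longleftrightarrow>
      (\<forall>i\<in>I. meager_in T {f \<in> U. (f, x) \<in> S i})" for x
  proof
    show "\<forall>i\<in>I. meager_in T {f \<in> U. (f, x) \<in> S i}"
      if "meager_in T (\<Union>i\<in>I. {f \<in> U. (f, x) \<in> S i})"
      using that by (auto elim: meager_in_subset)
  qed (simp add: meager_in_UN[OF assms])
  ultimately show ?thesis by auto
qed

text \<open>The category quantifier preserves Borel sets, by induction on \<open>B\<close>. It is
  what makes the Vaught transforms \<open>Y\<close> Borel, although the group may be
  uncountable.\<close>

lemma nonmeager_section_borel_of:
  assumes T: "completely_metrizable_space T" "second_countable T" and X: "second_countable X"
    and B: "B \<in> sets (borel_of (prod_topology T X))" and U: "openin T U"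
  shows "{x \<in> topspace X. \<not> meager_in T {f \<in> U. (f, x) \<in> B}} \<in> sets (borel_of X)"
proof -
  obtain \<B> where \<B>: "countable \<B>" "\<forall>V\<in>\<B>. openin T V"
    "\<forall>U x. openin T U \<and> x \<in> U \<longrightarrow> (\<exists>V\<in>\<B>. x \<in> V \<and> V \<subseteq> U)"
    using T unfolding second_countable_def by blast
  obtain \<R> where \<R>: "countable \<R>"
    "\<And>p. p \<in> \<R> \<Longrightarrow> openin T (fst p) \<and> openin X (snd p)"
    "\<And>Q. openin (prod_topology T X) Q \<Longrightarrow> Q = (\<Union>p\<in>{p \<in> \<R>. fst p \<times> snd p \<subseteq> Q}. fst p \<times> snd p)"
    by (rule second_countable_prod_open_UN[OF T(2) X]) (rule that)
  let ?N = "\<lambda>B U. {x \<in> topspace X. \<not> meager_in T {f \<in> U. (f, x) \<in> B}}"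
  \<comment> \<open>\<open>U\<close> is quantified inside the induction because the complement case
    uses the hypothesis for the basic open subsets of \<open>U\<close>.\<close>
  have "\<forall>U. openin T U \<longrightarrow> ?N B U \<in> sets (borel_of X)"
    using B unfolding sets_borel_of[of "prod_topology T X"]
  proof (induction rule: sigma_sets.induct)
    case (Basic B)
    then have Q: "openin (prod_topology T X) B" by simp
    show ?case
    proof (intro allI impI)
      fix U assume U: "openin T U"
      define I where "I = {p \<in> \<R>. fst p \<times> snd p \<subseteq> B}"
      have I: "countable I"
        unfolding I_def by (rule countable_subset[OF _ \<R>(1)]) auto
      have Beq: "B = (\<Union>p\<in>I. fst p \<times> snd p)"
        unfolding I_def by (rule \<R>(3)[OF Q])
      have "?N (fst p \<times> snd p) U \<in> sets (borel_of X)" if "p \<in> I" for p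
      proof -
        have VW: "openin T (fst p)" "openin X (snd p)"
          using \<R>(2)[of p] that by (simp_all add: I_def)
        show ?thesis
        proof (cases "U \<inter> fst p = {}")
          case True
          then have "{f \<in> U. (f, x) \<in> fst p \<times> snd p} = {}" for x by auto
          then have "?N (fst p \<times> snd p) U = {}" by (simp only: meager_in_empty) auto
          then show ?thesis by (metis sets.empty_sets)
        next
          case False
          then have nm: "\<not> meager_in T (U \<inter> fst p)"
            using openin_not_meager_in[OF T(1)] VW(1) U by blast
          have "meager_in T {f \<in> U. (f, x) \<in> fst p \<times> snd p} \<longleftrightarrow> x \<notin> snd p" for x
          proof (cases "x \<in> snd p")
            case True
            then have "{f \<in> U. (f, x) \<in> fst p \<times> snd p} = U \<inter> fst p" by auto
            then show ?thesis using nm True by simp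
          qed simp
          then have "?N (fst p \<times> snd p) U = snd p" using openin_subset[OF VW(2)] by blast
          then show ?thesis using VW openin_borel_of by metis
        qed
      qed
      then have "(\<Union>p\<in>I. ?N (fst p \<times> snd p) U) \<in> sets (borel_of X)"
        by (intro sets.countable_UN''[OF I])
      then show "?N B U \<in> sets (borel_of X)"
        unfolding Beq nonmeager_section_UN[OF I] .
    qed
  next
    case Empty then show ?case by simp
  next
    case (Compl B)
    let ?C = "topspace (prod_topology T X) - B"
    show ?case
    proof (intro allI impI)
      fix U assume U: "openin T U"
      let ?I = "{V \<in> \<B>. V \<subseteq> U \<and> V \<noteq> {}}"
      \<comment> \<open>Complementation turns the quantifier into a countable union over basic sets
        \<open>V\<close>. One direction uses the Baire property of the section, the other that
        \<open>V\<close> itself is not meager.\<close>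
      have *: "(\<not> meager_in T {f \<in> U. (f, x) \<in> ?C}) \<longleftrightarrow> (\<exists>V\<in>?I. meager_in T {f \<in> V. (f, x) \<in> B})"
        if x: "x \<in> topspace X" for x
      proof
        let ?S = "{f \<in> topspace T. (f, x) \<in> ?C}"
        have ao: "almost_open T ?S"
        proof (rule borel_of_almost_open[OF T(2)], rule section_borel_of[OF _ x])
          show "?C \<in> sets (borel_of (prod_topology T X))"
            using Compl.hyps unfolding sets_borel_of by (rule sigma_sets.Compl)
        qed
        assume nm: "\<not> meager_in T {f \<in> U. (f, x) \<in> ?C}"
        have "{f \<in> U. (f, x) \<in> ?C} = U \<inter> ?S"
          using openin_subset[OF U] by auto
        with nm obtain V where V: "openin T V" "V \<noteq> {}" "V \<subseteq> U" "meager_in T (V - ?S)"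
          using almost_open_nonmeagerD[OF T(2) ao U] by auto
        then obtain v where "v \<in> V" by auto
        then obtain W where W: "W \<in> \<B>" "v \<in> W" "W \<subseteq> V" using \<B>(3) V(1) by meson
        have "{f \<in> W. (f, x) \<in> B} \<subseteq> V - ?S" using W by auto
        then show "\<exists>V\<in>?I. meager_in T {f \<in> V. (f, x) \<in> B}"
          using W V meager_in_subset by blast
      next
        assume "\<exists>V\<in>?I. meager_in T {f \<in> V. (f, x) \<in> B}"
        then obtain V where V: "V \<in> \<B>" "V \<subseteq> U" "V \<noteq> {}" "meager_in T {f \<in> V. (f, x) \<in> B}"
          by blast
        have oV: "openin T V" using V(1) \<B>(2) by simp
        show "\<not> meager_in T {f \<in> U. (f, x) \<in> ?C}"
        proof
          assume "meager_in T {f \<in> U. (f, x) \<in> ?C}"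
          then have "meager_in T ({f \<in> U. (f, x) \<in> ?C} \<union> {f \<in> V. (f, x) \<in> B})"
            using V(4) by (rule meager_in_Un)
          moreover have "V \<subseteq> {f \<in> U. (f, x) \<in> ?C} \<union> {f \<in> V. (f, x) \<in> B}"
            using openin_subset[OF oV] V(2) x by auto
          ultimately show False
            using openin_not_meager_in[OF T(1) oV V(3)] meager_in_subset by blast
        qed
      qed
      have "?N ?C U = {x \<in> topspace X. \<exists>V\<in>?I. meager_in T {f \<in> V. (f, x) \<in> B}}"
        using * by (intro Collect_cong) blast
      also have "\<dots> = (\<Union>V\<in>?I. topspace X - ?N B V)" by blast
      also have "\<dots> \<in> sets (borel_of X)"
      proof (rule sets.countable_UN'')
        show "countable ?I" by (rule countable_subset[OF _ \<B>(1)]) auto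
        fix V assume "V \<in> ?I"
        then have "openin T V" using \<B>(2) by simp
        then have "?N B V \<in> sets (borel_of X)" using Compl.IH by blast
        then show "topspace X - ?N B V \<in> sets (borel_of X)"
          using sets.compl_sets[of _ "borel_of X"] by simp
      qed
      finally show "?N ?C U \<in> sets (borel_of X)" .
    qed
  next
    case (Union S)
    show ?case
    proof (intro allI impI)
      fix U assume U: "openin T U"
      have "(\<Union>i\<in>UNIV. ?N (S i) U) \<in> sets (borel_of X)"
        using Union.IH U by (intro sets.countable_UN''[OF countableI_type]) blast
      then show "?N (\<Union>i. S i) U \<in> sets (borel_of X)"
        unfolding nonmeager_section_UN[OF countableI_type] .
    qed
  qed
  then show ?thesis using U by blast
qed

subsection \<open>Permutation groups on a countable set\<close>

text \<open>The last assumption expresses, by finite tuples, that \<open>A\<close> is closed in the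
  group of all permutations of \<open>\<Omega>\<close> under pointwise convergence.\<close>

locale closed_perm_group =
  fixes \<Omega> :: "'a set" and A :: "('a \<Rightarrow> 'a) set"
  assumes subgroup_A: "subgroup A (BijGroup \<Omega>)"
    and countable_\<Omega>: "countable \<Omega>"
    and closed_A: "\<And>f. f \<in> Bij \<Omega> \<Longrightarrow> (\<And>vs. vs \<in> lists \<Omega> \<Longrightarrow> \<exists>g\<in>A. map g vs = map f vs) \<Longrightarrow> f \<in> A"
begin

definition G :: "('a \<Rightarrow> 'a) monoid" where
  "G = BijGroup \<Omega> \<lparr>carrier := A\<rparr>"

abbreviation Prod :: "('a \<Rightarrow> 'a) topology" where
  "Prod \<equiv> product_topology (\<lambda>_. discrete_topology \<Omega>) \<Omega>"

definition T :: "('a \<Rightarrow> 'a) topology" where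
  "T = subtopology Prod A"

definition cyl :: "'a list \<Rightarrow> 'a list \<Rightarrow> ('a \<Rightarrow> 'a) set" where
  "cyl c a = {f \<in> A. map f c = a}"

definition Fix :: "'a set \<Rightarrow> ('a \<Rightarrow> 'a) set" where
  "Fix R = {f \<in> A. \<forall>r\<in>R. f r = r}"

lemma carrier_G [simp]: "carrier G = A"
  by (simp add: G_def)

lemma A_Bij: "f \<in> A \<Longrightarrow> f \<in> Bij \<Omega>"
  using subgroup.subset[OF subgroup_A] by (auto simp: BijGroup_def)

lemma group_G: "group G"
  unfolding G_def by (rule subgroup.subgroup_is_group[OF subgroup_A group_BijGroup])

sublocale group G by (rule group_G)

lemma A_closed: "f \<in> A \<Longrightarrow> v \<in> \<Omega> \<Longrightarrow> f v \<in> \<Omega>"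
  using Bij_imp_funcset[OF A_Bij] by auto

lemma A_map_closed: "f \<in> A \<Longrightarrow> c \<in> lists \<Omega> \<Longrightarrow> map f c \<in> lists \<Omega>"
  using A_closed by auto

lemma A_ext: "f \<in> A \<Longrightarrow> g \<in> A \<Longrightarrow> (\<And>v. v \<in> \<Omega> \<Longrightarrow> f v = g v) \<Longrightarrow> f = g"
  using extensionalityI[OF Bij_imp_extensional[OF A_Bij] Bij_imp_extensional[OF A_Bij]] by blast

lemma mult_apply: "f \<in> A \<Longrightarrow> g \<in> A \<Longrightarrow> v \<in> \<Omega> \<Longrightarrow> (f \<otimes>\<^bsub>G\<^esub> g) v = f (g v)"
  by (simp add: G_def BijGroup_def A_Bij compose_eq)

lemma one_apply: "v \<in> \<Omega> \<Longrightarrow> \<one>\<^bsub>G\<^esub> v = v"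
  by (simp add: G_def BijGroup_def)

lemma inv_A [simp]: "f \<in> A \<Longrightarrow> inv\<^bsub>G\<^esub> f \<in> A"
  using inv_closed by simp

lemma mult_A [simp]: "f \<in> A \<Longrightarrow> g \<in> A \<Longrightarrow> f \<otimes>\<^bsub>G\<^esub> g \<in> A"
  using m_closed by simp

lemma one_A [simp]: "\<one>\<^bsub>G\<^esub> \<in> A"
  using one_closed by simp

lemma inv_apply1: "f \<in> A \<Longrightarrow> v \<in> \<Omega> \<Longrightarrow> (inv\<^bsub>G\<^esub> f) (f v) = v"
  using mult_apply[OF inv_A, of f f v] by (simp add: one_apply)

lemma inv_apply2: "f \<in> A \<Longrightarrow> v \<in> \<Omega> \<Longrightarrow> f ((inv\<^bsub>G\<^esub> f) v) = v"
  using mult_apply[OF _ inv_A, of f f v] by (simp add: one_apply)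

lemma inv_apply_eq: "f \<in> A \<Longrightarrow> u \<in> \<Omega> \<Longrightarrow> v \<in> \<Omega> \<Longrightarrow> (inv\<^bsub>G\<^esub> f) u = v \<longleftrightarrow> f v = u"
  using inv_apply1 inv_apply2 by auto

lemma map_mult: "f \<in> A \<Longrightarrow> g \<in> A \<Longrightarrow> c \<in> lists \<Omega> \<Longrightarrow> map (f \<otimes>\<^bsub>G\<^esub> g) c = map f (map g c)"
  by (auto simp: mult_apply)

lemma map_inv: "g \<in> A \<Longrightarrow> c \<in> lists \<Omega> \<Longrightarrow> map g (map (inv\<^bsub>G\<^esub> g) c) = c"
  using map_mult[of g "inv\<^bsub>G\<^esub> g" c] by (simp add: inv_A map_idI one_apply in_lists_conv_set)

lemma Fix_A: "f \<in> Fix R \<Longrightarrow> f \<in> A"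
  by (simp add: Fix_def)

lemma one_Fix: "R \<subseteq> \<Omega> \<Longrightarrow> \<one>\<^bsub>G\<^esub> \<in> Fix R"
  using one_A one_apply by (auto simp: Fix_def)

lemma mult_Fix: "R \<subseteq> \<Omega> \<Longrightarrow> f \<in> Fix R \<Longrightarrow> g \<in> Fix R \<Longrightarrow> f \<otimes>\<^bsub>G\<^esub> g \<in> Fix R"
  by (auto simp: Fix_def mult_apply mult_A subset_iff)

lemma inv_Fix:
  assumes "R \<subseteq> \<Omega>" "f \<in> Fix R"
  shows "inv\<^bsub>G\<^esub> f \<in> Fix R"
proof -
  have "(inv\<^bsub>G\<^esub> f) r = r" if "r \<in> R" for r
    using inv_apply1[of f r] assms that by (auto simp: Fix_def)
  then show ?thesis using assms inv_A by (simp add: Fix_def)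
qed

lemma Fix_antimono: "R \<subseteq> R' \<Longrightarrow> Fix R' \<subseteq> Fix R"
  by (auto simp: Fix_def)

lemma openin_product_cyl:
  assumes "c \<in> lists \<Omega>"
  shows "openin Prod {f \<in> \<Omega> \<rightarrow>\<^sub>E \<Omega>. map f c = a}"
  using assms
proof (induction c arbitrary: a)
  case Nil
  have "openin Prod (topspace Prod)" by (rule openin_topspace)
  then show ?case by (cases "a = []") auto
next
  case vc: (Cons v c)
  show ?case
  proof (cases a)
    case Nil then show ?thesis by simp
  next
    case a: (Cons b a')
    have "continuous_map Prod (discrete_topology \<Omega>) (\<lambda>f. f v)"
      using continuous_map_product_projection[of v \<Omega> "\<lambda>_. discrete_topology \<Omega>"] vc by simp
    then have "openin Prod {f \<in> topspace Prod. f v \<in> {b} \<inter> \<Omega>}"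
      by (rule openin_continuous_map_preimage) simp
    moreover have "{f \<in> topspace Prod. f v \<in> {b} \<inter> \<Omega>} = {f \<in> \<Omega> \<rightarrow>\<^sub>E \<Omega>. f v = b}"
      using vc by auto
    moreover have "openin Prod {f \<in> \<Omega> \<rightarrow>\<^sub>E \<Omega>. map f c = a'}"
      using vc by blast
    ultimately have "openin Prod ({f \<in> \<Omega> \<rightarrow>\<^sub>E \<Omega>. f v = b} \<inter> {f \<in> \<Omega> \<rightarrow>\<^sub>E \<Omega>. map f c = a'})"
      by (simp add: openin_Int)
    moreover have "{f \<in> \<Omega> \<rightarrow>\<^sub>E \<Omega>. f v = b} \<inter> {f \<in> \<Omega> \<rightarrow>\<^sub>E \<Omega>. map f c = a'} =
        {f \<in> \<Omega> \<rightarrow>\<^sub>E \<Omega>. map f (v # c) = a}"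
      using a by auto
    ultimately show ?thesis by simp
  qed
qed

lemma openin_productI:
  assumes "U \<subseteq> \<Omega> \<rightarrow>\<^sub>E \<Omega>"
    and "\<And>f. f \<in> U \<Longrightarrow> \<exists>c\<in>lists \<Omega>. {g \<in> \<Omega> \<rightarrow>\<^sub>E \<Omega>. map g c = map f c} \<subseteq> U"
  shows "openin Prod U"
proof (subst openin_subopen, intro ballI)
  fix f assume f: "f \<in> U"
  then obtain c where "c \<in> lists \<Omega>" "{g \<in> \<Omega> \<rightarrow>\<^sub>E \<Omega>. map g c = map f c} \<subseteq> U"
    using assms(2) by blast
  then show "\<exists>V. openin Prod V \<and> f \<in> V \<and> V \<subseteq> U"
    using openin_product_cyl[of c "map f c"] f assms(1)
    by (intro exI[of _ "{g \<in> \<Omega> \<rightarrow>\<^sub>E \<Omega>. map g c = map f c}"] conjI) auto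
qed

lemma A_PiE: "A \<subseteq> \<Omega> \<rightarrow>\<^sub>E \<Omega>"
  using Bij_imp_funcset[OF A_Bij] Bij_imp_extensional[OF A_Bij] by (simp add: PiE_def subset_iff)

lemma topspace_T [simp]: "topspace T = A"
  using A_PiE by (auto simp: T_def)

lemma openin_cyl: "c \<in> lists \<Omega> \<Longrightarrow> openin T (cyl c a)"
  unfolding T_def openin_subtopology
  using openin_product_cyl[of c a] A_PiE
  by (intro exI[of _ "{f \<in> \<Omega> \<rightarrow>\<^sub>E \<Omega>. map f c = a}"]) (auto simp: cyl_def)

lemma openin_T_cyl:
  assumes "openin T U" "f \<in> U"
  shows "\<exists>c\<in>lists \<Omega>. cyl c (map f c) \<subseteq> U"
proof -
  obtain U' where U': "openin Prod U'" "U = U' \<inter> A"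
    using assms(1) unfolding T_def openin_subtopology by blast
  obtain V where V: "finite {i \<in> \<Omega>. V i \<noteq> topspace (discrete_topology \<Omega>)}"
    "f \<in> Pi\<^sub>E \<Omega> V" "Pi\<^sub>E \<Omega> V \<subseteq> U'"
    using U' assms(2) unfolding openin_product_topology_alt by blast
  \<comment> \<open>A basic open box restricts only finitely many coordinates, and \<open>c\<close>
    lists them.\<close>
  obtain c where c: "set c = {i \<in> \<Omega>. V i \<noteq> \<Omega>}"
    using finite_list[OF V(1)] by auto
  have "g \<in> U" if g: "g \<in> cyl c (map f c)" for g
  proof -
    have gA: "g \<in> A" using g by (simp add: cyl_def)
    have "g i \<in> V i" if i: "i \<in> \<Omega>" for i
    proof (cases "V i = \<Omega>")
      case True then show ?thesis using A_closed gA i by simp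
    next
      case False
      then have "i \<in> set c" using c i by simp
      then have "g i = f i" using g by (auto simp: cyl_def)
      then show ?thesis using V(2) i by auto
    qed
    then have "g \<in> Pi\<^sub>E \<Omega> V" using gA A_PiE by (auto simp: PiE_def)
    then show ?thesis using V(3) U' gA by auto
  qed
  then show ?thesis using c by (intro bexI[of _ c]) auto
qed

lemma openinI_T:
  assumes "U \<subseteq> A" and "\<And>f. f \<in> U \<Longrightarrow> \<exists>c\<in>lists \<Omega>. cyl c (map f c) \<subseteq> U"
  shows "openin T U"
proof (subst openin_subopen, intro ballI)
  fix f assume f: "f \<in> U"
  then obtain c where "c \<in> lists \<Omega>" "cyl c (map f c) \<subseteq> U"
    using assms(2) by blast
  then show "\<exists>V. openin T V \<and> f \<in> V \<and> V \<subseteq> U"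
    using openin_cyl[of c "map f c"] f assms(1)
    by (intro exI[of _ "cyl c (map f c)"] conjI) (auto simp: cyl_def)
qed

lemma second_countable_T: "second_countable T"
  unfolding second_countable_def
proof (intro exI conjI allI impI ballI)
  let ?B = "(\<lambda>(c, a). cyl c a) ` (lists \<Omega> \<times> lists \<Omega>)"
  show "countable ?B"
    using countable_\<Omega> by (intro countable_image countable_SIGMA countable_lists)
  show "openin T V" if "V \<in> ?B" for V
    using that openin_cyl by auto
  fix U f assume "openin T U \<and> f \<in> U"
  then have f: "openin T U" "f \<in> U" "f \<in> A"
    using openin_subset[of T U] by auto
  then obtain c where c: "c \<in> lists \<Omega>" "cyl c (map f c) \<subseteq> U" using openin_T_cyl by blast
  then have "map f c \<in> lists \<Omega>" using f A_map_closed by blast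
  then show "\<exists>V\<in>?B. f \<in> V \<and> V \<subseteq> U"
    using c f by (intro bexI[of _ "cyl c (map f c)"]) (auto simp: cyl_def intro!: image_eqI[of _ _ "(c, map f c)"])
qed

text \<open>\<open>A\<close> need not be closed in the product, since a pointwise limit of
  permutations may fail to be surjective. But injectivity (\<open>I\<close>), surjectivity
  (\<open>J\<close>) and agreement with members of \<open>A\<close> on finite tuples
  (\<open>K\<close>) are each given by countably many open conditions.\<close>

lemma gdelta_A: "gdelta_in Prod A"
proof -
  define I where "I = (\<lambda>(v, w). {f \<in> \<Omega> \<rightarrow>\<^sub>E \<Omega>. f v = f w \<longrightarrow> v = w}) ` (\<Omega> \<times> \<Omega>)"
  define J where "J = (\<lambda>u. {f \<in> \<Omega> \<rightarrow>\<^sub>E \<Omega>. u \<in> f ` \<Omega>}) ` \<Omega>"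
  define K where "K = (\<lambda>c. {f \<in> \<Omega> \<rightarrow>\<^sub>E \<Omega>. \<exists>g\<in>A. map g c = map f c}) ` lists \<Omega>"
  have "openin Prod U" if I: "U \<in> I" for U
  proof -
    obtain v w where U: "U = {f \<in> \<Omega> \<rightarrow>\<^sub>E \<Omega>. f v = f w \<longrightarrow> v = w}" "v \<in> \<Omega>" "w \<in> \<Omega>"
      using I by (auto simp: I_def)
    show ?thesis
    proof (rule openin_productI)
      fix f assume "f \<in> U"
      then show "\<exists>c\<in>lists \<Omega>. {g \<in> \<Omega> \<rightarrow>\<^sub>E \<Omega>. map g c = map f c} \<subseteq> U"
        using U by (intro bexI[of _ "[v, w]"]) auto
    qed (use U in auto)
  qed
  moreover have "openin Prod U" if J: "U \<in> J" for U
  proof -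
    obtain u where U: "U = {f \<in> \<Omega> \<rightarrow>\<^sub>E \<Omega>. u \<in> f ` \<Omega>}" "u \<in> \<Omega>"
      using J by (auto simp: J_def)
    show ?thesis
    proof (rule openin_productI)
      fix f assume "f \<in> U"
      then obtain v where "v \<in> \<Omega>" "u = f v" using U by auto
      then show "\<exists>c\<in>lists \<Omega>. {g \<in> \<Omega> \<rightarrow>\<^sub>E \<Omega>. map g c = map f c} \<subseteq> U"
        using U by (intro bexI[of _ "[v]"]) (auto intro!: rev_image_eqI[of v])
    qed (use U in auto)
  qed
  moreover have "openin Prod U" if K: "U \<in> K" for U
  proof -
    obtain c where U: "U = {f \<in> \<Omega> \<rightarrow>\<^sub>E \<Omega>. \<exists>g\<in>A. map g c = map f c}" "c \<in> lists \<Omega>"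
      using K by (auto simp: K_def)
    show ?thesis
    proof (rule openin_productI)
      fix f assume "f \<in> U"
      then show "\<exists>c\<in>lists \<Omega>. {g \<in> \<Omega> \<rightarrow>\<^sub>E \<Omega>. map g c = map f c} \<subseteq> U"
        using U by (intro bexI[of _ c]) (auto simp del: map_eq_conv)
    qed (use U in auto)
  qed
  ultimately have "gdelta_in Prod U" if "U \<in> insert (topspace Prod) (I \<union> J \<union> K)" for U
    using that open_imp_gdelta_in by blast
  moreover have "countable (insert (topspace Prod) (I \<union> J \<union> K))"
    unfolding I_def J_def K_def using countable_\<Omega>
    by (intro countable_insert countable_Un countable_image countable_SIGMA countable_lists)
  ultimately have "gdelta_in Prod (\<Inter>(insert (topspace Prod) (I \<union> J \<union> K)))"
    by (intro gdelta_in_Inter) auto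
  moreover have "\<Inter>(insert (topspace Prod) (I \<union> J \<union> K)) = A"
  proof (intro equalityI subsetI)
    fix f assume f: "f \<in> \<Inter>(insert (topspace Prod) (I \<union> J \<union> K))"
    then have fP: "f \<in> \<Omega> \<rightarrow>\<^sub>E \<Omega>" by simp
    have "inj_on f \<Omega>"
    proof (rule inj_onI)
      fix v w assume vw: "v \<in> \<Omega>" "w \<in> \<Omega>" "f v = f w"
      then have "{f \<in> \<Omega> \<rightarrow>\<^sub>E \<Omega>. f v = f w \<longrightarrow> v = w} \<in> I" by (auto simp: I_def)
      then show "v = w" using f vw by blast
    qed
    moreover have "\<Omega> \<subseteq> f ` \<Omega>"
    proof
      fix u assume "u \<in> \<Omega>"
      then have "{f \<in> \<Omega> \<rightarrow>\<^sub>E \<Omega>. u \<in> f ` \<Omega>} \<in> J" by (auto simp: J_def)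
      then show "u \<in> f ` \<Omega>" using f by blast
    qed
    ultimately have "f \<in> Bij \<Omega>"
      using fP by (auto simp: Bij_def bij_betw_def PiE_def)
    then show "f \<in> A"
    proof (rule closed_A)
      fix c assume "c \<in> lists \<Omega>"
      then have "{f \<in> \<Omega> \<rightarrow>\<^sub>E \<Omega>. \<exists>g\<in>A. map g c = map f c} \<in> K" by (auto simp: K_def)
      then show "\<exists>g\<in>A. map g c = map f c" using f by blast
    qed
  next
    fix f assume f: "f \<in> A"
    then have "bij_betw f \<Omega> \<Omega>" using A_Bij by (simp add: Bij_def)
    then have "inj_on f \<Omega>" "f ` \<Omega> = \<Omega>" by (auto simp: bij_betw_def)
    then show "f \<in> \<Inter>(insert (topspace Prod) (I \<union> J \<union> K))"
      using f A_PiE by (auto simp: I_def J_def K_def dest: inj_onD)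
  qed
  ultimately show ?thesis by simp
qed

lemma polish_T: "polish_space T"
proof -
  have "countable {i \<in> \<Omega>. \<not> (\<exists>a. topspace (discrete_topology \<Omega>) \<subseteq> {a})}"
    by (rule countable_subset[OF _ countable_\<Omega>]) auto
  then have "completely_metrizable_space Prod"
    unfolding completely_metrizable_space_product_topology
    by (intro disjI2) (simp add: completely_metrizable_space_discrete_topology)
  then have "completely_metrizable_space T"
    unfolding T_def using gdelta_A by (rule completely_metrizable_space_gdelta_in)
  then show ?thesis
    using second_countable_T second_countable_imp_separable_space by (simp add: polish_space_def)
qed

lemma completely_metrizable_T: "completely_metrizable_space T"
  using polish_T by (simp add: polish_space_def)

lemma continuous_right_mult:
  assumes g: "g \<in> A"
  shows "continuous_map T T (\<lambda>f. f \<otimes>\<^bsub>G\<^esub> g)"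
  unfolding continuous_map_def
proof (intro conjI allI impI)
  show "(\<lambda>f. f \<otimes>\<^bsub>G\<^esub> g) \<in> topspace T \<rightarrow> topspace T" using g mult_A by simp
  fix U assume U: "openin T U"
  show "openin T {f \<in> topspace T. f \<otimes>\<^bsub>G\<^esub> g \<in> U}"
  proof (rule openinI_T)
    fix f assume "f \<in> {f \<in> topspace T. f \<otimes>\<^bsub>G\<^esub> g \<in> U}"
    then have f: "f \<in> A" "f \<otimes>\<^bsub>G\<^esub> g \<in> U" by auto
    obtain c where c: "c \<in> lists \<Omega>" "cyl c (map (f \<otimes>\<^bsub>G\<^esub> g) c) \<subseteq> U"
      using openin_T_cyl[OF U f(2)] by blast
    have "h \<otimes>\<^bsub>G\<^esub> g \<in> cyl c (map (f \<otimes>\<^bsub>G\<^esub> g) c)"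
      if "h \<in> cyl (map g c) (map f (map g c))" for h
      using that c(1) f(1) g mult_A map_mult by (simp add: cyl_def)
    then show "\<exists>c\<in>lists \<Omega>. cyl c (map f c) \<subseteq> {f \<in> topspace T. f \<otimes>\<^bsub>G\<^esub> g \<in> U}"
      using c A_map_closed[OF g c(1)] by (intro bexI[of _ "map g c"]) (auto simp: cyl_def)
  qed auto
qed

lemma homeomorphic_right_mult:
  assumes g: "g \<in> A"
  shows "homeomorphic_map T T (\<lambda>f. f \<otimes>\<^bsub>G\<^esub> g)"
proof -
  have "homeomorphic_maps T T (\<lambda>f. f \<otimes>\<^bsub>G\<^esub> g) (\<lambda>f. f \<otimes>\<^bsub>G\<^esub> inv\<^bsub>G\<^esub> g)"
    unfolding homeomorphic_maps_def
    using g inv_A by (auto simp: continuous_right_mult m_assoc)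
  then show ?thesis using homeomorphic_map_maps by blast
qed

end

subsection \<open>Borel actions\<close>

text \<open>\<open>W\<close> enumerates a base of \<open>X\<close>. It is fixed here because the
  transforms \<open>Y\<close> depend on it.\<close>

locale borel_perm_action = closed_perm_group \<Omega> A
  for \<Omega> :: "'a set" and A :: "('a \<Rightarrow> 'a) set" +
  fixes X :: "'x topology" and \<phi> :: "('a \<Rightarrow> 'a) \<Rightarrow> 'x \<Rightarrow> 'x" and W :: "nat \<Rightarrow> 'x set"
  assumes polish_X: "polish_space X"
    and borel_action: "borel_action G T X \<phi>"
    and open_W: "\<And>k. openin X (W k)"
    and base_W: "\<And>U x. openin X U \<Longrightarrow> x \<in> U \<Longrightarrow> \<exists>k. x \<in> W k \<and> W k \<subseteq> U"
begin

sublocale group_action G "topspace X" \<phi>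
  using borel_action by (simp add: borel_action_def)

lemma measurable_\<phi>: "(\<lambda>(g, x). \<phi> g x) \<in> borel_of (prod_topology T X) \<rightarrow>\<^sub>M borel_of X"
  using borel_action by (simp add: borel_action_def)

lemma second_countable_X: "second_countable X"
  using polish_X by (rule polish_space_imp_second_countable)

lemma Hausdorff_X: "Hausdorff_space X"
  using polish_X by (rule polish_space_imp_Hausdorff_space)

lemma \<phi>_closed: "f \<in> A \<Longrightarrow> x \<in> topspace X \<Longrightarrow> \<phi> f x \<in> topspace X"
  using element_image[of f x] by simp

lemma \<phi>_mult: "f \<in> A \<Longrightarrow> g \<in> A \<Longrightarrow> x \<in> topspace X \<Longrightarrow> \<phi> (f \<otimes>\<^bsub>G\<^esub> g) x = \<phi> f (\<phi> g x)"
  using composition_rule[of x f g] by simp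

lemma \<phi>_one: "x \<in> topspace X \<Longrightarrow> \<phi> \<one>\<^bsub>G\<^esub> x = x"
  using id_eq_one by (metis restrict_apply')

lemma \<phi>_inv: "f \<in> A \<Longrightarrow> x \<in> topspace X \<Longrightarrow> \<phi> (inv\<^bsub>G\<^esub> f) (\<phi> f x) = x"
  using orbit_sym_aux[of f x] by simp

text \<open>
  The Vaught transform: \<open>(c, a)\<close> stands for the coset of all \<open>f\<close> that map the tuple \<open>c\<close> to \<open>a\<close>. Each
  pair \<open>(k, a)\<close> thus gives a relation on tuples \<open>c\<close> that depends equivariantly on \<open>y\<close>.
\<close>

definition Y :: "nat \<Rightarrow> 'a list \<Rightarrow> 'a list \<Rightarrow> 'x \<Rightarrow> bool" where
  "Y k c a y \<longleftrightarrow> \<not> meager_in T {f \<in> cyl c a. \<phi> f y \<in> W k}"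

lemma Y_borel:
  assumes c: "c \<in> lists \<Omega>"
  shows "{y \<in> topspace X. Y k c a y} \<in> sets (borel_of X)"
proof -
  define B where "B = (\<lambda>(g, x). \<phi> g x) -` W k \<inter> space (borel_of (prod_topology T X))"
  have B: "B \<in> sets (borel_of (prod_topology T X))"
    unfolding B_def by (rule measurable_sets[OF measurable_\<phi> openin_borel_of[OF open_W]])
  have "{f \<in> cyl c a. (f, y) \<in> B} = {f \<in> cyl c a. \<phi> f y \<in> W k}" if "y \<in> topspace X" for y
    using that by (auto simp: B_def cyl_def)
  then have "{y \<in> topspace X. Y k c a y} = {y \<in> topspace X. \<not> meager_in T {f \<in> cyl c a. (f, y) \<in> B}}"
    unfolding Y_def by (intro Collect_cong conj_cong) simp_all
  also have "\<dots> \<in> sets (borel_of X)"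
    by (intro nonmeager_section_borel_of completely_metrizable_T second_countable_T
        second_countable_X B openin_cyl c)
  finally show ?thesis .
qed

text \<open>Substitute \<open>f \<otimes> g\<close> for \<open>f\<close>: it sends \<open>c\<close>
  to \<open>a\<close> if \<open>f\<close> sends \<open>map g c\<close> to \<open>a\<close>, and it
  moves \<open>\<phi> (inv g) y\<close> to \<open>\<phi> f y\<close>. This substitution is undone by
  a right translation, which preserves meagerness.\<close>

lemma Y_act_imp:
  assumes g: "g \<in> A" and y: "y \<in> topspace X" and c: "c \<in> lists \<Omega>"
    and Y: "Y k (map g c) a y"
  shows "Y k c a (\<phi> (inv\<^bsub>G\<^esub> g) y)"
proof (rule ccontr)
  let ?S = "{f \<in> cyl c a. \<phi> f (\<phi> (inv\<^bsub>G\<^esub> g) y) \<in> W k}"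
  let ?S' = "{f \<in> cyl (map g c) a. \<phi> f y \<in> W k}"
  assume "\<not> Y k c a (\<phi> (inv\<^bsub>G\<^esub> g) y)"
  then have "meager_in T ?S" by (simp add: Y_def)
  then have "meager_in T ((\<lambda>f. f \<otimes>\<^bsub>G\<^esub> inv\<^bsub>G\<^esub> g) ` ?S)"
    by (intro homeomorphic_map_meager_in[OF homeomorphic_right_mult]) (auto simp: inv_A g cyl_def)
  moreover have "?S' \<subseteq> (\<lambda>f. f \<otimes>\<^bsub>G\<^esub> inv\<^bsub>G\<^esub> g) ` ?S"
  proof
    fix f assume f: "f \<in> ?S'"
    then have fA: "f \<in> A" by (simp add: cyl_def)
    have "\<phi> (f \<otimes>\<^bsub>G\<^esub> g) (\<phi> (inv\<^bsub>G\<^esub> g) y) = \<phi> f y"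
      using fA g y inv_A mult_A by (simp flip: \<phi>_mult add: m_assoc)
    then have "f \<otimes>\<^bsub>G\<^esub> g \<in> ?S"
      using f fA g c by (simp add: cyl_def mult_A map_mult del: map_map)
    moreover have "f = (f \<otimes>\<^bsub>G\<^esub> g) \<otimes>\<^bsub>G\<^esub> inv\<^bsub>G\<^esub> g"
      using fA g by (simp add: m_assoc)
    ultimately show "f \<in> (\<lambda>f. f \<otimes>\<^bsub>G\<^esub> inv\<^bsub>G\<^esub> g) ` ?S"
      by (intro image_eqI[of _ _ "f \<otimes>\<^bsub>G\<^esub> g"])
  qed
  ultimately have "meager_in T ?S'" by (rule meager_in_subset)
  then show False using Y by (simp add: Y_def)
qed

lemma Y_act:
  assumes g: "g \<in> A" and y: "y \<in> topspace X" and c: "c \<in> lists \<Omega>"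
  shows "Y k c a (\<phi> g y) \<longleftrightarrow> Y k (map (inv\<^bsub>G\<^esub> g) c) a y"
proof
  assume "Y k c a (\<phi> g y)"
  then have "Y k (map g (map (inv\<^bsub>G\<^esub> g) c)) a (\<phi> g y)"
    using map_inv[OF g c] by simp
  from Y_act_imp[OF g \<phi>_closed[OF g y] A_map_closed[OF inv_A[OF g] c] this]
  show "Y k (map (inv\<^bsub>G\<^esub> g) c) a y" using \<phi>_inv[OF g y] by simp
next
  assume "Y k (map (inv\<^bsub>G\<^esub> g) c) a y"
  from Y_act_imp[OF inv_A[OF g] y c this]
  show "Y k c a (\<phi> g y)" using g by simp
qed

text \<open>The values of \<open>Y\<close> at \<open>y\<close> determine each set of all
  \<open>f\<close> with \<open>\<phi> f y \<in> W k\<close> up to a meager set. A generic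
  \<open>f\<close> therefore cannot separate \<open>\<phi> f y\<close> from
  \<open>\<phi> f y'\<close>.\<close>

lemma Y_inj:
  assumes y: "y \<in> topspace X" "y' \<in> topspace X"
    and eq: "\<And>k c a. c \<in> lists \<Omega> \<Longrightarrow> a \<in> lists \<Omega> \<Longrightarrow> Y k c a y \<longleftrightarrow> Y k c a y'"
  shows "y = y'"
proof -
  define S where "S k y = {f \<in> A. \<phi> f y \<in> W k}" for k y
  have S: "S k y \<in> sets (borel_of T)" if "y \<in> topspace X" for k y
  proof -
    let ?B = "(\<lambda>(g, x). \<phi> g x) -` W k \<inter> space (borel_of (prod_topology T X))"
    have "?B \<in> sets (borel_of (prod_topology T X))"
      by (rule measurable_sets[OF measurable_\<phi> openin_borel_of[OF open_W]])
    from section_borel_of[OF this that]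
    show ?thesis using that by (simp add: S_def conj_commute cong: conj_cong)
  qed
  \<comment> \<open>Otherwise the difference is comeager in some cylinder by the Baire property, and
    this cylinder is a \<open>(c, a)\<close> for which \<open>Y k c a\<close> holds at
    \<open>y\<close> and fails at \<open>y'\<close>.\<close>
  have "meager_in T (S k y - S k y')" for k
  proof (rule ccontr)
    assume nm: "\<not> meager_in T (S k y - S k y')"
    have "A \<inter> (S k y - S k y') = S k y - S k y'" by (auto simp: S_def)
    moreover have "almost_open T (S k y - S k y')"
      by (intro borel_of_almost_open second_countable_T sets.Diff S y)
    ultimately obtain V where V: "openin T V" "V \<noteq> {}" "meager_in T (V - (S k y - S k y'))"
      using almost_open_nonmeagerD[OF second_countable_T, of "S k y - S k y'" A] nm
        openin_topspace[of T] by auto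
    then obtain f where f: "f \<in> V" by auto
    then have fA: "f \<in> A" using openin_subset[OF V(1)] by auto
    obtain c where c: "c \<in> lists \<Omega>" "cyl c (map f c) \<subseteq> V" using openin_T_cyl[OF V(1) f] by blast
    let ?U = "cyl c (map f c)"
    have U: "openin T ?U" using c openin_cyl by blast
    have a: "map f c \<in> lists \<Omega>" using A_map_closed fA c by blast
    have "meager_in T {g \<in> ?U. \<phi> g y' \<in> W k}"
      by (rule meager_in_subset[OF V(3)]) (use c(2) in \<open>auto simp: S_def\<close>)
    then have "\<not> Y k c (map f c) y'" by (simp add: Y_def)
    then have "\<not> Y k c (map f c) y" using eq c a by blast
    then have "meager_in T {g \<in> ?U. \<phi> g y \<in> W k}" by (simp add: Y_def)
    then have "meager_in T ({g \<in> ?U. \<phi> g y \<in> W k} \<union> (V - (S k y - S k y')))"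
      using V(3) by (rule meager_in_Un)
    moreover have "?U \<subseteq> {g \<in> ?U. \<phi> g y \<in> W k} \<union> (V - (S k y - S k y'))"
      using c(2) by (auto simp: S_def)
    ultimately have "meager_in T ?U" by (rule meager_in_subset)
    moreover have "f \<in> ?U" using fA by (simp add: cyl_def)
    ultimately show False
      using openin_not_meager_in[OF completely_metrizable_T U] by auto
  qed
  then have "meager_in T (\<Union>k. S k y - S k y')" by (intro meager_in_UN) auto
  moreover have "\<not> meager_in T A"
    using openin_not_meager_in[OF completely_metrizable_T, of A] openin_topspace[of T] one_A
    by (simp del: one_A) blast
  ultimately have "\<not> A \<subseteq> (\<Union>k. S k y - S k y')" using meager_in_subset by blast
  \<comment> \<open>This \<open>f\<close> avoids countably many meager differences, so each basic
    neighbourhood of \<open>\<phi> f y\<close> contains \<open>\<phi> f y'\<close>.\<close>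
  then obtain f where f: "f \<in> A" "\<And>k. f \<in> S k y \<Longrightarrow> f \<in> S k y'" by blast
  have "\<phi> f y = \<phi> f y'"
  proof (rule ccontr)
    assume "\<phi> f y \<noteq> \<phi> f y'"
    then obtain U U' where "openin X U" "openin X U'" "\<phi> f y \<in> U" "\<phi> f y' \<in> U'" "disjnt U U'"
      using Hausdorff_X \<phi>_closed f(1) y unfolding Hausdorff_space_def by meson
    moreover from this obtain k where "\<phi> f y \<in> W k" "W k \<subseteq> U" using base_W by blast
    ultimately show False using f by (auto simp: S_def disjnt_iff)
  qed
  then show ?thesis using \<phi>_inv f(1) y by metis
qed

end

section \<open>Limits of successive approximations in a closed permutation group\<close>

context closed_perm_group begin

text \<open>The left side is how corrections are composed in the construction. The right side says
  that they keep every value that already lies in \<open>R\<close>.\<close>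

lemma mult_inv_Fix_iff:
  assumes "g \<in> A" "g' \<in> A" "R \<subseteq> \<Omega>"
  shows "g' \<otimes>\<^bsub>G\<^esub> inv\<^bsub>G\<^esub> g \<in> Fix R \<longleftrightarrow> (\<forall>v\<in>\<Omega>. g v \<in> R \<longrightarrow> g' v = g v)"
proof
  assume F: "g' \<otimes>\<^bsub>G\<^esub> inv\<^bsub>G\<^esub> g \<in> Fix R"
  show "\<forall>v\<in>\<Omega>. g v \<in> R \<longrightarrow> g' v = g v"
  proof (intro ballI impI)
    fix v assume v: "v \<in> \<Omega>" "g v \<in> R"
    then have "(g' \<otimes>\<^bsub>G\<^esub> inv\<^bsub>G\<^esub> g) (g v) = g v" using F by (simp add: Fix_def)
    then show "g' v = g v" using assms v by (simp add: mult_apply A_closed inv_apply1)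
  qed
next
  assume *: "\<forall>v\<in>\<Omega>. g v \<in> R \<longrightarrow> g' v = g v"
  have "(g' \<otimes>\<^bsub>G\<^esub> inv\<^bsub>G\<^esub> g) r = r" if r: "r \<in> R" for r
  proof -
    have "r \<in> \<Omega>" using r assms by auto
    moreover from this have "(inv\<^bsub>G\<^esub> g) r \<in> \<Omega>" using assms by (simp add: A_closed)
    ultimately show ?thesis
      using * r assms by (metis inv_apply2 inv_A mult_apply)
  qed
  then show "g' \<otimes>\<^bsub>G\<^esub> inv\<^bsub>G\<^esub> g \<in> Fix R" using assms by (simp add: Fix_def)
qed

text \<open>A value is frozen as soon as it lies in \<open>R s\<close>. By \<open>dom\<close> every
  value is frozen eventually, which defines \<open>l\<close>. By \<open>ran\<close> every
  \<open>u\<close> enters some \<open>R s\<close>, and its preimage under \<open>g s\<close> then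
  keeps the value \<open>u\<close>, so \<open>l\<close> is surjective. Closedness of
  \<open>A\<close> does the rest.\<close>

lemma limit_exists:
  assumes gA: "\<And>s. g s \<in> A" and R: "\<And>s. R s \<subseteq> \<Omega>" "\<And>s. R s \<subseteq> R (Suc s)"
    and step: "\<And>s. g (Suc s) \<otimes>\<^bsub>G\<^esub> inv\<^bsub>G\<^esub> (g s) \<in> Fix (R s)"
    and dom: "\<And>v. v \<in> \<Omega> \<Longrightarrow> \<exists>s. g s v \<in> R s" and ran: "\<And>u. u \<in> \<Omega> \<Longrightarrow> \<exists>s. u \<in> R s"
  shows "\<exists>l\<in>A. \<forall>s. l \<otimes>\<^bsub>G\<^esub> inv\<^bsub>G\<^esub> (g s) \<in> Fix (R s)"
proof -
  have stable: "g t v = g s v \<and> g t v \<in> R t" if "s \<le> t" "v \<in> \<Omega>" "g s v \<in> R s" for s t v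
    using that(1)
  proof (induction t rule: dec_induct)
    case base then show ?case using that by simp
  next
    case (step t)
    then have "g (Suc t) v = g t v"
      using mult_inv_Fix_iff[OF gA gA R(1)] assms(4) that(2) by metis
    then show ?case using step.IH R(2)[of t] by auto
  qed
  obtain \<sigma> where \<sigma>: "\<And>v. v \<in> \<Omega> \<Longrightarrow> g (\<sigma> v) v \<in> R (\<sigma> v)"
    using dom by metis
  define l where "l = (\<lambda>v\<in>\<Omega>. g (\<sigma> v) v)"
  have l_eq: "l v = g s v" if "v \<in> \<Omega>" "g s v \<in> R s" for s v
    using stable[of s "max s (\<sigma> v)" v] stable[of "\<sigma> v" "max s (\<sigma> v)" v] \<sigma>[of v] that
    by (simp add: l_def)
  have l_ge: "l v = g t v" if "v \<in> \<Omega>" "\<sigma> v \<le> t" for t v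
    using stable[of "\<sigma> v" t v] \<sigma>[of v] that by (simp add: l_def)
  have "inj_on l \<Omega>"
  proof (rule inj_onI)
    fix v w assume vw: "v \<in> \<Omega>" "w \<in> \<Omega>" "l v = l w"
    then have "g (max (\<sigma> v) (\<sigma> w)) v = g (max (\<sigma> v) (\<sigma> w)) w"
      using l_ge[of v "max (\<sigma> v) (\<sigma> w)"] l_ge[of w "max (\<sigma> v) (\<sigma> w)"] by simp
    then show "v = w" using inv_apply1[OF gA] vw by metis
  qed
  moreover have "l ` \<Omega> = \<Omega>"
  proof (intro equalityI subsetI)
    show "u \<in> \<Omega>" if "u \<in> l ` \<Omega>" for u using that A_closed[OF gA] by (auto simp: l_def)
    fix u assume u: "u \<in> \<Omega>"
    then obtain s where s: "u \<in> R s" using ran by blast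
    have "(inv\<^bsub>G\<^esub> (g s)) u \<in> \<Omega>" "g s ((inv\<^bsub>G\<^esub> (g s)) u) = u"
      using A_closed[OF inv_A[OF gA]] inv_apply2[OF gA] u by auto
    then show "u \<in> l ` \<Omega>" using l_eq s by (metis imageI)
  qed
  ultimately have "l \<in> Bij \<Omega>" by (simp add: Bij_def bij_betw_def l_def)
  then have "l \<in> A"
  proof (rule closed_A)
    fix vs assume vs: "vs \<in> lists \<Omega>"
    define t where "t = Max (insert 0 (\<sigma> ` set vs))"
    have "g t v = l v" if "v \<in> set vs" for v
      using l_ge[of v t] that vs by (auto simp: t_def)
    then have "map (g t) vs = map l vs" by simp
    then show "\<exists>g\<in>A. map g vs = map l vs" using gA by blast
  qed
  moreover have "l \<otimes>\<^bsub>G\<^esub> inv\<^bsub>G\<^esub> (g s) \<in> Fix (R s)" for s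
    using mult_inv_Fix_iff[OF gA \<open>l \<in> A\<close> R(1)] l_eq by blast
  ultimately show ?thesis by blast
qed

end

section \<open>Coding two group elements into one point of an orbit\<close>

text \<open>The assumption says that the pointwise stabilizer of a finite set has only finitely many
  orbits on \<open>\<Omega>\<close>; \<open>S\<close> meets each of them.\<close>

locale oligomorphic_borel_action = borel_perm_action \<Omega> A X \<phi> W
  for \<Omega> :: "'a set" and A X and \<phi> :: "('a \<Rightarrow> 'a) \<Rightarrow> 'x \<Rightarrow> 'x" and W +
  assumes oligomorphic: "\<And>R. R \<in> Fpow \<Omega> \<Longrightarrow>
      \<exists>S. finite S \<and> S \<subseteq> \<Omega> \<and> (\<forall>v\<in>\<Omega>. \<exists>f\<in>Fix R. f v \<in> S)"
begin

text \<open>Enumerates the indices of the atomic facts \<open>Y k c a\<close>. The order is fixed in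
  advance, so that the first varying fact is canonical.\<close>

definition loc :: "nat \<Rightarrow> nat \<times> 'a list \<times> 'a list" where
  "loc = from_nat_into (UNIV \<times> lists \<Omega> \<times> lists \<Omega>)"

text \<open>Only \<open>c\<close> counts: by \<open>Y_act\<close> the group moves \<open>c\<close>,
  while \<open>k\<close> and \<open>a\<close> merely name the relation.\<close>

definition support :: "nat \<Rightarrow> 'a set" where
  "support n = set (fst (snd (loc n)))"

definition Yn :: "nat \<Rightarrow> 'x \<Rightarrow> bool" where
  "Yn n y \<longleftrightarrow> Y (fst (loc n)) (fst (snd (loc n))) (snd (snd (loc n))) y"

definition varies :: "'a set \<Rightarrow> nat \<Rightarrow> 'x \<Rightarrow> bool" where
  "varies R n y \<longleftrightarrow> (\<exists>f\<in>Fix R. Yn n (\<phi> f y)) \<and> (\<exists>f\<in>Fix R. \<not> Yn n (\<phi> f y))"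

text \<open>The value is arbitrary if nothing varies, which happens only for open stabilizers.\<close>

definition site :: "'a set \<Rightarrow> 'x \<Rightarrow> nat" where
  "site R y = (LEAST n. varies R n y)"

text \<open>Chosen from \<open>R\<close> alone, so that coder and decoder add the same
  elements.\<close>

definition reps :: "'a set \<Rightarrow> 'a set" where
  "reps R = (SOME S. finite S \<and> S \<subseteq> \<Omega> \<and> (\<forall>v\<in>\<Omega>. \<exists>f\<in>Fix R. f v \<in> S))"

text \<open>Task \<open>(i, u, v)\<close> asks whether the coded element with index \<open>i\<close>
  sends \<open>v\<close> to \<open>u\<close>.\<close>

definition task :: "nat \<Rightarrow> bool \<times> 'a \<times> 'a" where
  "task = from_nat_into (UNIV \<times> \<Omega> \<times> \<Omega>)"

text \<open>The intersection with \<open>\<Omega>\<close> is needed only if \<open>\<Omega>\<close> is empty and \<open>task\<close> has junk values.\<close>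

definition grow :: "nat \<Rightarrow> 'a set \<Rightarrow> 'a set" where
  "grow s R = R \<union> reps R \<union> ({fst (snd (task s))} \<inter> \<Omega>)"

text \<open>Adding the support of the site protects the bit stored there from later corrections, as
  \<open>nxt_bit_act\<close> shows.\<close>

definition nxt :: "nat \<Rightarrow> 'a set \<Rightarrow> 'x \<Rightarrow> 'a set" where
  "nxt s R y = grow s R \<union> support (site (grow s R) y)"

definition bit_at :: "nat \<Rightarrow> 'a set \<Rightarrow> 'x \<Rightarrow> bool" where
  "bit_at s R y \<longleftrightarrow> Yn (site (grow s R) y) y"

text \<open>The decoder's replay of the construction: it uses \<open>y\<close> alone and not the
  point from which \<open>y\<close> was reached.\<close>

primrec stage :: "nat \<Rightarrow> 'x \<Rightarrow> 'a set" where
  "stage 0 y = {}"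
| "stage (Suc s) y = nxt s (stage s y) y"

definition decoded :: "bool \<Rightarrow> 'a \<Rightarrow> 'a \<Rightarrow> 'x \<Rightarrow> bool" where
  "decoded i u v y \<longleftrightarrow> (\<exists>s. task s = (i, u, v) \<and> bit_at s (stage s y) y)"

definition legit :: "bool \<Rightarrow> 'x \<Rightarrow> bool" where
  "legit i y \<longleftrightarrow> (\<exists>f\<in>A. \<forall>u\<in>\<Omega>. \<forall>v\<in>\<Omega>. decoded i u v y \<longleftrightarrow> f v = u)"

text \<open>The default value is harmless for the graph: the identity relates a point only to
  itself.\<close>

definition elem :: "bool \<Rightarrow> 'x \<Rightarrow> 'a \<Rightarrow> 'a" where
  "elem i y = (if legit i y then SOME f. f \<in> A \<and> (\<forall>u\<in>\<Omega>. \<forall>v\<in>\<Omega>. decoded i u v y \<longleftrightarrow> f v = u)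
     else \<one>\<^bsub>G\<^esub>)"

lemma loc_in: "fst (snd (loc n)) \<in> lists \<Omega>" "snd (snd (loc n)) \<in> lists \<Omega>"
proof -
  have "loc n \<in> UNIV \<times> lists \<Omega> \<times> lists \<Omega>"
    unfolding loc_def by (rule from_nat_into) blast
  then show "fst (snd (loc n)) \<in> lists \<Omega>" "snd (snd (loc n)) \<in> lists \<Omega>" by auto
qed

lemma loc_surj: "c \<in> lists \<Omega> \<Longrightarrow> a \<in> lists \<Omega> \<Longrightarrow> \<exists>n. loc n = (k, c, a)"
  unfolding loc_def using countable_\<Omega>
  by (intro from_nat_into_surj countable_SIGMA countable_lists) auto

lemma task_surj: "u \<in> \<Omega> \<Longrightarrow> v \<in> \<Omega> \<Longrightarrow> \<exists>s. task s = (i, u, v)"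
  unfolding task_def using countable_\<Omega>
  by (intro from_nat_into_surj countable_SIGMA) auto

lemma support_Fpow: "support n \<in> Fpow \<Omega>"
  using loc_in(1)[of n] by (auto simp: support_def Fpow_def)

lemma reps:
  assumes "R \<in> Fpow \<Omega>"
  shows "reps R \<in> Fpow \<Omega>" "\<And>v. v \<in> \<Omega> \<Longrightarrow> \<exists>f\<in>Fix R. f v \<in> reps R"
proof -
  have "finite (reps R) \<and> reps R \<subseteq> \<Omega> \<and> (\<forall>v\<in>\<Omega>. \<exists>f\<in>Fix R. f v \<in> reps R)"
    unfolding reps_def by (rule someI_ex[OF oligomorphic[OF assms]])
  then show "reps R \<in> Fpow \<Omega>" "\<And>v. v \<in> \<Omega> \<Longrightarrow> \<exists>f\<in>Fix R. f v \<in> reps R"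
    by (simp_all add: Fpow_def)
qed

lemma Fpow_Un: "R \<in> Fpow \<Omega> \<Longrightarrow> R' \<in> Fpow \<Omega> \<Longrightarrow> R \<union> R' \<in> Fpow \<Omega>"
  by (auto simp: Fpow_def)

lemma grow_Fpow: "R \<in> Fpow \<Omega> \<Longrightarrow> grow s R \<in> Fpow \<Omega>"
  unfolding grow_def by (intro Fpow_Un reps) (auto simp: Fpow_def)

lemma nxt_Fpow: "R \<in> Fpow \<Omega> \<Longrightarrow> nxt s R y \<in> Fpow \<Omega>"
  unfolding nxt_def by (intro Fpow_Un grow_Fpow support_Fpow)

lemma Fpow_subset: "R \<in> Fpow \<Omega> \<Longrightarrow> R \<subseteq> \<Omega>"
  by (simp add: Fpow_def)

lemma Yn_Fix:
  assumes y: "y \<in> topspace X" and f: "f \<in> Fix (support n)"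
  shows "Yn n (\<phi> f y) \<longleftrightarrow> Yn n y"
proof -
  have "inv\<^bsub>G\<^esub> f \<in> Fix (support n)" using f support_Fpow Fpow_subset inv_Fix by blast
  then have "map (inv\<^bsub>G\<^esub> f) (fst (snd (loc n))) = fst (snd (loc n))"
    by (intro map_idI) (simp add: Fix_def support_def)
  then show ?thesis unfolding Yn_def using Y_act[OF Fix_A[OF f] y loc_in(1)] by simp
qed

text \<open>Right translation by \<open>g\<close> permutes \<open>Fix R\<close>, so both sides range
  over the same orbit.\<close>

lemma Fix_act_ex:
  assumes "y \<in> topspace X" "R \<subseteq> \<Omega>" "g \<in> Fix R"
  shows "(\<exists>f\<in>Fix R. Q (\<phi> f (\<phi> g y))) \<longleftrightarrow> (\<exists>f\<in>Fix R. Q (\<phi> f y))"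
proof
  assume "\<exists>f\<in>Fix R. Q (\<phi> f (\<phi> g y))"
  then obtain f where "f \<in> Fix R" "Q (\<phi> f (\<phi> g y))" by blast
  then show "\<exists>f\<in>Fix R. Q (\<phi> f y)"
    using assms by (intro bexI[of _ "f \<otimes>\<^bsub>G\<^esub> g"]) (auto simp: mult_Fix \<phi>_mult Fix_A)
next
  assume "\<exists>f\<in>Fix R. Q (\<phi> f y)"
  then obtain f where "f \<in> Fix R" "Q (\<phi> f y)" by blast
  then show "\<exists>f\<in>Fix R. Q (\<phi> f (\<phi> g y))"
    using assms
    by (intro bexI[of _ "f \<otimes>\<^bsub>G\<^esub> inv\<^bsub>G\<^esub> g"])
      (auto simp: mult_Fix \<phi>_mult Fix_A inv_Fix \<phi>_inv \<phi>_closed)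
qed

lemma site_act:
  assumes "y \<in> topspace X" "R \<subseteq> \<Omega>" "g \<in> Fix R"
  shows "site R (\<phi> g y) = site R y"
proof -
  have "varies R n (\<phi> g y) \<longleftrightarrow> varies R n y" for n
    unfolding varies_def
    using Fix_act_ex[OF assms, of "Yn n"] Fix_act_ex[OF assms, of "\<lambda>y. \<not> Yn n y"] by simp
  then show ?thesis by (simp add: site_def)
qed

text \<open>A correction \<open>f\<close> fixes \<open>grow s R\<close>, hence leaves the site
  unchanged, and it fixes the support of the site, hence leaves the bit unchanged.\<close>

lemma nxt_bit_act:
  assumes y: "y \<in> topspace X" and R: "R \<in> Fpow \<Omega>" and f: "f \<in> Fix (nxt s R y)"
  shows "nxt s R (\<phi> f y) = nxt s R y" "bit_at s R (\<phi> f y) \<longleftrightarrow> bit_at s R y"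
proof -
  have "f \<in> Fix (grow s R)" and f': "f \<in> Fix (support (site (grow s R) y))"
    using f Fix_antimono by (auto simp: nxt_def Fix_def)
  then have "site (grow s R) (\<phi> f y) = site (grow s R) y"
    by (intro site_act y Fpow_subset grow_Fpow R)
  then show "nxt s R (\<phi> f y) = nxt s R y" "bit_at s R (\<phi> f y) \<longleftrightarrow> bit_at s R y"
    using Yn_Fix[OF y f'] by (simp_all add: nxt_def bit_at_def)
qed

text \<open>By \<open>Y_inj\<close> some atomic fact distinguishes \<open>y\<close> from
  \<open>\<phi> f y\<close>.\<close>

lemma varies_exists:
  assumes y: "y \<in> topspace X" and R: "R \<subseteq> \<Omega>" and f: "f \<in> Fix R" "\<phi> f y \<noteq> y"
  shows "\<exists>n. varies R n y"
proof -
  obtain k c a where kca: "c \<in> lists \<Omega>" "a \<in> lists \<Omega>" "Y k c a (\<phi> f y) \<noteq> Y k c a y"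
    using Y_inj[OF \<phi>_closed[OF Fix_A[OF f(1)] y] y] f(2) by blast
  then obtain n where "loc n = (k, c, a)" using loc_surj by blast
  then have "Yn n (\<phi> f y) \<noteq> Yn n (\<phi> \<one>\<^bsub>G\<^esub> y)" using kca by (simp add: Yn_def \<phi>_one y)
  then show ?thesis using f(1) one_Fix[OF R] unfolding varies_def by blast
qed

text \<open>One step of the coder corrects \<open>g\<close> twice. First \<open>f1\<close> moves the
  value at \<open>v\<close> to a representative of its orbit under \<open>Fix R\<close>. Then
  \<open>f2\<close>, which fixes that representative, adjusts the bit. The intended bit
  \<open>\<beta>\<close> may depend on the element being built, so it must be invariant under
  \<open>f2\<close>.\<close>

lemma write_bit:
  assumes x: "x \<in> topspace X" and nt: "\<And>R. R \<in> Fpow \<Omega> \<Longrightarrow> \<exists>f\<in>Fix R. \<phi> f x \<noteq> x"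
    and g: "g \<in> A" and R: "R \<in> Fpow \<Omega>"
    and \<beta>: "\<And>f g'. f \<in> Fix (grow s R) \<Longrightarrow> g' \<in> A \<Longrightarrow> \<beta> (f \<otimes>\<^bsub>G\<^esub> g') \<longleftrightarrow> \<beta> g'"
    and v: "v \<in> \<Omega>"
  shows "\<exists>g'\<in>A. g' \<otimes>\<^bsub>G\<^esub> inv\<^bsub>G\<^esub> g \<in> Fix R \<and> g' v \<in> nxt s R (\<phi> g' x) \<and>
      (bit_at s R (\<phi> g' x) \<longleftrightarrow> \<beta> g')"
proof -
  obtain f1 where f1: "f1 \<in> Fix R" "f1 (g v) \<in> reps R"
    using reps(2)[OF R A_closed[OF g v]] by blast
  define R' where "R' = grow s R"
  have R': "R' \<in> Fpow \<Omega>" "R' \<subseteq> \<Omega>" "R \<subseteq> R'" "reps R \<subseteq> R'"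
    using grow_Fpow[OF R] Fpow_subset by (auto simp: R'_def grow_def)
  define g1 where "g1 = f1 \<otimes>\<^bsub>G\<^esub> g"
  have g1: "g1 \<in> A" using f1 g Fix_A by (simp add: g1_def)
  define y where "y = \<phi> g1 x"
  have y: "y \<in> topspace X" using g1 x \<phi>_closed by (simp add: y_def)
  \<comment> \<open>The stabilizer of \<open>R'\<close> must move \<open>y\<close>. This follows by
    conjugation with \<open>g1\<close> from \<open>nt\<close> at the preimage of \<open>R'\<close>,
    whose stabilizer moves \<open>x\<close>.\<close>
  have "(inv\<^bsub>G\<^esub> g1) ` R' \<in> Fpow \<Omega>"
    using R' A_closed[OF inv_A[OF g1]] by (auto simp: Fpow_def)
  then obtain f where f: "f \<in> Fix ((inv\<^bsub>G\<^esub> g1) ` R')" "\<phi> f x \<noteq> x" using nt by blast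
  have fA: "f \<in> A" using f Fix_A by blast
  have "f ((inv\<^bsub>G\<^esub> g1) r) = (inv\<^bsub>G\<^esub> g1) r" if "r \<in> R'" for r
    using f(1) that by (simp add: Fix_def)
  then have "g1 \<otimes>\<^bsub>G\<^esub> f \<otimes>\<^bsub>G\<^esub> inv\<^bsub>G\<^esub> g1 \<in> Fix R'"
    using R'(2) g1 fA
    by (auto simp: Fix_def mult_apply A_closed inv_apply2 subset_iff)
  moreover have "\<phi> (g1 \<otimes>\<^bsub>G\<^esub> f \<otimes>\<^bsub>G\<^esub> inv\<^bsub>G\<^esub> g1) y = \<phi> g1 (\<phi> f x)"
    using g1 fA x by (simp add: y_def \<phi>_mult \<phi>_closed \<phi>_inv)
  moreover have "\<phi> g1 (\<phi> f x) \<noteq> y"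
    using f(2) g1 fA x unfolding y_def by (metis \<phi>_inv \<phi>_closed)
  ultimately have "\<exists>n. varies R' n y"
    using varies_exists[OF y R'(2)] by metis
  then have "varies R' (site R' y) y" unfolding site_def by (rule LeastI_ex)
  \<comment> \<open>A varying fact takes both truth values on the orbit, so the intended one can be
    reached.\<close>
  then obtain f2 where f2: "f2 \<in> Fix R'" "Yn (site R' y) (\<phi> f2 y) \<longleftrightarrow> \<beta> g1"
    unfolding varies_def by metis
  have f2A: "f2 \<in> A" and f1A: "f1 \<in> A" using f1 f2 Fix_A by auto
  define g' where "g' = f2 \<otimes>\<^bsub>G\<^esub> g1"
  have g': "g' \<in> A" using f2A g1 by (simp add: g'_def)
  have eq: "\<phi> g' x = \<phi> f2 y" using f2A g1 x by (simp add: g'_def y_def \<phi>_mult)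
  have "bit_at s R (\<phi> g' x) \<longleftrightarrow> \<beta> g1"
    using f2(2) site_act[OF y R'(2) f2(1)] by (simp add: eq bit_at_def flip: R'_def)
  also have "\<dots> \<longleftrightarrow> \<beta> g'"
    using \<beta>[of f2 g1] f2(1) g1 by (simp add: g'_def R'_def)
  finally have "bit_at s R (\<phi> g' x) \<longleftrightarrow> \<beta> g'" .
  moreover have "g' v \<in> nxt s R (\<phi> g' x)"
  proof -
    have "g1 v \<in> reps R" using f1 f1A g v by (simp add: g1_def mult_apply)
    moreover from this have "g' v = g1 v"
      using f2 f2A g1 v R'(4) by (auto simp: g'_def mult_apply Fix_def)
    ultimately show ?thesis using R'(4) by (auto simp: nxt_def R'_def)
  qed
  moreover have "g' \<otimes>\<^bsub>G\<^esub> inv\<^bsub>G\<^esub> g \<in> Fix R"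
  proof -
    have "g' \<otimes>\<^bsub>G\<^esub> inv\<^bsub>G\<^esub> g = f2 \<otimes>\<^bsub>G\<^esub> f1"
      using f2A f1A g by (simp add: g'_def g1_def m_assoc)
    then show ?thesis
      using mult_Fix[OF Fpow_subset[OF R]] f1(1) f2(1) Fix_antimono[OF R'(3)] by auto
  qed
  ultimately show ?thesis using g' by blast
qed

lemma elem_A: "elem i y \<in> A"
  unfolding elem_def legit_def
  using someI_ex[of "\<lambda>f. f \<in> A \<and> (\<forall>u\<in>\<Omega>. \<forall>v\<in>\<Omega>. decoded i u v y \<longleftrightarrow> f v = u)"] by auto

lemma elem_eq:
  assumes f: "f \<in> A" and "\<And>u v. u \<in> \<Omega> \<Longrightarrow> v \<in> \<Omega> \<Longrightarrow> decoded i u v y \<longleftrightarrow> f v = u"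
  shows "elem i y = f"
proof -
  have "legit i y" using assms unfolding legit_def by blast
  moreover have "(SOME f. f \<in> A \<and> (\<forall>u\<in>\<Omega>. \<forall>v\<in>\<Omega>. decoded i u v y \<longleftrightarrow> f v = u)) = f"
  proof (rule some_equality)
    fix f' assume f': "f' \<in> A \<and> (\<forall>u\<in>\<Omega>. \<forall>v\<in>\<Omega>. decoded i u v y \<longleftrightarrow> f' v = u)"
    show "f' = f"
    proof (rule A_ext)
      fix v assume v: "v \<in> \<Omega>"
      then have "decoded i (f v) v y" using assms(2)[of "f v" v] A_closed[OF f v] by simp
      then show "f' v = f v" using f' v A_closed[OF f v] by blast
    qed (use f f' in auto)
  qed (use assms in auto)
  ultimately show ?thesis by (simp add: elem_def)
qed

text \<open>Iterates \<open>write_bit\<close> and passes to the limit. The assumption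
  \<open>nt\<close> says that the stabilizer of \<open>x\<close> is not open, so there is always a
  fact left that can carry a bit.\<close>

lemma common_neighbour:
  assumes x: "x \<in> topspace X" and nt: "\<And>R. R \<in> Fpow \<Omega> \<Longrightarrow> \<exists>f\<in>Fix R. \<phi> f x \<noteq> x"
    and h: "h \<in> A"
  shows "\<exists>g\<in>A. elem True (\<phi> g x) = g \<and> elem False (\<phi> g x) = g \<otimes>\<^bsub>G\<^esub> inv\<^bsub>G\<^esub> h"
proof -
  have "{} \<in> Fpow \<Omega>" by (simp add: Fpow_def)
  then obtain f where f: "f \<in> A" "\<phi> f x \<noteq> x" using nt Fix_A by blast
  \<comment> \<open>Otherwise the group is trivial and moves nothing; hence all values of
    \<open>task\<close> are genuine.\<close>
  have "\<Omega> \<noteq> {}"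
  proof
    assume "\<Omega> = {}"
    then have "f = \<one>\<^bsub>G\<^esub>" using f A_ext[OF f(1) one_A] by blast
    then show False using f x \<phi>_one by simp
  qed
  then have task: "fst (snd (task s)) \<in> \<Omega> \<and> snd (snd (task s)) \<in> \<Omega>" for s
    using from_nat_into[of "(UNIV :: bool set) \<times> \<Omega> \<times> \<Omega>" s] unfolding task_def by auto
  \<comment> \<open>The conditions mean that \<open>g\<close>, respectively
    \<open>g \<otimes> inv h\<close>, sends \<open>v\<close> to \<open>u\<close>. In terms of
    inverses only \<open>(inv g) u\<close> matters, and this is unchanged when \<open>g\<close> is
    multiplied on the left by an element fixing \<open>u\<close>. Since \<open>u\<close> belongs to
    \<open>grow s R\<close>, the invariance required by \<open>write_bit\<close> holds.\<close>
  define \<beta> where "\<beta> s g \<longleftrightarrow> (case task s of (i, u, v) \<Rightarrow>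
      if i then (inv\<^bsub>G\<^esub> g) u = v else h ((inv\<^bsub>G\<^esub> g) u) = v)" for s g
  have \<beta>: "\<beta> s (f \<otimes>\<^bsub>G\<^esub> g) \<longleftrightarrow> \<beta> s g" if "f \<in> Fix (grow s R)" "R \<in> Fpow \<Omega>" "g \<in> A" for s f g R
  proof -
    obtain i u v where iuv: "task s = (i, u, v)" by (cases "task s")
    then have u: "u \<in> \<Omega>" "u \<in> grow s R" using task[of s] by (auto simp: grow_def)
    have "inv\<^bsub>G\<^esub> f \<in> Fix (grow s R)" 
      using inv_Fix[OF Fpow_subset[OF grow_Fpow[OF that(2)]] that(1)] .
    then have "(inv\<^bsub>G\<^esub> f) u = u" using u by (simp add: Fix_def)
    then have "(inv\<^bsub>G\<^esub> (f \<otimes>\<^bsub>G\<^esub> g)) u = (inv\<^bsub>G\<^esub> g) u"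
      using Fix_A[OF that(1)] that(3) u by (simp add: inv_mult_group mult_apply)
    then show ?thesis by (simp add: \<beta>_def iuv)
  qed
  \<comment> \<open>A state is the current approximation together with the finite set of protected
    elements.\<close>
  define Q where "Q s p q \<longleftrightarrow> snd q = nxt s (snd p) (\<phi> (fst q) x) \<and>
      fst q \<otimes>\<^bsub>G\<^esub> inv\<^bsub>G\<^esub> (fst p) \<in> Fix (snd p) \<and> fst q (snd (snd (task s))) \<in> snd q \<and>
      (bit_at s (snd p) (\<phi> (fst q) x) \<longleftrightarrow> \<beta> s (fst q))" for s p q
  have "\<exists>F. \<forall>s. (fst (F s) \<in> A \<and> snd (F s) \<in> Fpow \<Omega> \<and> (s = 0 \<longrightarrow> snd (F s) = {})) \<and>
      Q s (F s) (F (Suc s))"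
  proof (rule dependent_nat_choice)
    show "\<exists>p. fst p \<in> A \<and> snd p \<in> Fpow \<Omega> \<and> ((0::nat) = 0 \<longrightarrow> snd p = {})"
      by (rule exI[of _ "(\<one>\<^bsub>G\<^esub>, {})"]) (simp add: Fpow_def)
  next
    fix p :: "('a \<Rightarrow> 'a) \<times> 'a set" and s :: nat
    assume p: "fst p \<in> A \<and> snd p \<in> Fpow \<Omega> \<and> (s = 0 \<longrightarrow> snd p = {})"
    have "\<exists>g'\<in>A. g' \<otimes>\<^bsub>G\<^esub> inv\<^bsub>G\<^esub> (fst p) \<in> Fix (snd p) \<and>
        g' (snd (snd (task s))) \<in> nxt s (snd p) (\<phi> g' x) \<and>
        (bit_at s (snd p) (\<phi> g' x) \<longleftrightarrow> \<beta> s g')"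
      using p task by (intro write_bit x nt \<beta>) auto
    then obtain g' where "g' \<in> A" "g' \<otimes>\<^bsub>G\<^esub> inv\<^bsub>G\<^esub> (fst p) \<in> Fix (snd p)"
      "g' (snd (snd (task s))) \<in> nxt s (snd p) (\<phi> g' x)"
      "bit_at s (snd p) (\<phi> g' x) \<longleftrightarrow> \<beta> s g'"
      by blast
    then show "\<exists>q. (fst q \<in> A \<and> snd q \<in> Fpow \<Omega> \<and> (Suc s = 0 \<longrightarrow> snd q = {})) \<and> Q s p q"
      using p nxt_Fpow by (intro exI[of _ "(g', nxt s (snd p) (\<phi> g' x))"]) (simp add: Q_def)
  qed
  then obtain F where F: "\<And>s. fst (F s) \<in> A" "\<And>s. snd (F s) \<in> Fpow \<Omega>" "snd (F 0) = {}"
      "\<And>s. Q s (F s) (F (Suc s))"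
    by auto
  define g where "g s = fst (F s)" for s
  define R where "R s = snd (F s)" for s
  have gA: "g s \<in> A" for s using F by (simp add: g_def)
  have RF: "R s \<in> Fpow \<Omega>" for s using F by (simp add: R_def)
  have R0: "R 0 = {}" using F by (simp add: R_def)
  have RSuc: "R (Suc s) = nxt s (R s) (\<phi> (g (Suc s)) x)"
    and gstep: "g (Suc s) \<otimes>\<^bsub>G\<^esub> inv\<^bsub>G\<^esub> (g s) \<in> Fix (R s)"
    and gv: "g (Suc s) (snd (snd (task s))) \<in> R (Suc s)"
    and gbit: "bit_at s (R s) (\<phi> (g (Suc s)) x) \<longleftrightarrow> \<beta> s (g (Suc s))" for s
    using F(4)[of s] unfolding g_def R_def Q_def by blast+
  have grow_R: "grow s (R s) \<subseteq> R (Suc s)" for s by (auto simp: RSuc nxt_def)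
  have "\<exists>l\<in>A. \<forall>s. l \<otimes>\<^bsub>G\<^esub> inv\<^bsub>G\<^esub> (g s) \<in> Fix (R s)"
  proof (rule limit_exists)
    show "R s \<subseteq> R (Suc s)" for s using grow_R[of s] by (auto simp: grow_def)
    \<comment> \<open>The step for a task freezes the value at its third component and adds its
      second component to \<open>R\<close>. The tasks \<open>(True, u, u)\<close> thus provide both
      conditions.\<close>
    show "\<exists>s. g s v \<in> R s" if "v \<in> \<Omega>" for v
      using task_surj[OF that that, of True] gv by (metis snd_conv)
    show "\<exists>s. u \<in> R s" if u: "u \<in> \<Omega>" for u
    proof -
      obtain s where "task s = (True, u, u)" using task_surj[OF u u] by blast
      then have "u \<in> grow s (R s)" using u by (simp add: grow_def)
      then show ?thesis using grow_R by blast
    qed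
  qed (use gA RF Fpow_subset gstep in auto)
  then obtain l where l: "l \<in> A" "\<And>s. l \<otimes>\<^bsub>G\<^esub> inv\<^bsub>G\<^esub> (g s) \<in> Fix (R s)" by blast
  define y where "y = \<phi> l x"
  have l_eq: "l = (l \<otimes>\<^bsub>G\<^esub> inv\<^bsub>G\<^esub> (g s)) \<otimes>\<^bsub>G\<^esub> g s" for s
    using l(1) gA by (simp add: m_assoc)
  have y_eq: "y = \<phi> (l \<otimes>\<^bsub>G\<^esub> inv\<^bsub>G\<^esub> (g s)) (\<phi> (g s) x)" for s
    unfolding y_def using l(1) gA x by (simp flip: \<phi>_mult add: m_assoc)
  \<comment> \<open>The limit differs from \<open>g (Suc s)\<close> by an element fixing
    \<open>R (Suc s)\<close>, so \<open>nxt_bit_act\<close> carries what was written at step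
    \<open>s\<close> over to \<open>y\<close>.\<close>
  have nxt_y: "nxt s (R s) y = R (Suc s)" "bit_at s (R s) y \<longleftrightarrow> \<beta> s l" for s
  proof -
    have *: "l \<otimes>\<^bsub>G\<^esub> inv\<^bsub>G\<^esub> (g (Suc s)) \<in> Fix (nxt s (R s) (\<phi> (g (Suc s)) x))"
      using l(2)[of "Suc s"] by (simp add: RSuc)
    note act = nxt_bit_act[OF \<phi>_closed[OF gA x] RF *, folded y_eq]
    show "nxt s (R s) y = R (Suc s)" using act(1) by (simp add: RSuc)
    have "bit_at s (R s) y \<longleftrightarrow> \<beta> s (g (Suc s))" using act(2) gbit by simp
    also have "\<dots> \<longleftrightarrow> \<beta> s ((l \<otimes>\<^bsub>G\<^esub> inv\<^bsub>G\<^esub> (g (Suc s))) \<otimes>\<^bsub>G\<^esub> g (Suc s))"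
      using \<beta>[OF _ RF gA] l(2)[of "Suc s"] Fix_antimono[OF grow_R[of s]] by blast
    also have "\<dots> \<longleftrightarrow> \<beta> s l" by (simp flip: l_eq)
    finally show "bit_at s (R s) y \<longleftrightarrow> \<beta> s l" .
  qed
  have stage_y: "stage s y = R s" for s
    by (induction s) (simp_all add: R0 nxt_y)
  have decoded_y: "decoded i u v y \<longleftrightarrow>
      (if i then (inv\<^bsub>G\<^esub> l) u = v else h ((inv\<^bsub>G\<^esub> l) u) = v)" if "u \<in> \<Omega>" "v \<in> \<Omega>" for i u v
  proof -
    have "decoded i u v y \<longleftrightarrow> (\<exists>s. task s = (i, u, v) \<and> \<beta> s l)"
      by (simp add: decoded_def stage_y nxt_y)
    then show ?thesis using task_surj[OF that, of i] by (auto simp: \<beta>_def)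
  qed
  have "elem True y = l"
    by (rule elem_eq) (use l decoded_y inv_apply_eq in auto)
  moreover have "elem False y = l \<otimes>\<^bsub>G\<^esub> inv\<^bsub>G\<^esub> h"
  proof (rule elem_eq)
    fix u v assume uv: "u \<in> \<Omega>" "v \<in> \<Omega>"
    have "h ((inv\<^bsub>G\<^esub> l) u) = (inv\<^bsub>G\<^esub> (l \<otimes>\<^bsub>G\<^esub> inv\<^bsub>G\<^esub> h)) u"
      using l h uv by (simp add: inv_mult_group mult_apply)
    then show "decoded False u v y \<longleftrightarrow> (l \<otimes>\<^bsub>G\<^esub> inv\<^bsub>G\<^esub> h) v = u"
      using decoded_y[OF uv, of False] inv_apply_eq[of "l \<otimes>\<^bsub>G\<^esub> inv\<^bsub>G\<^esub> h" u v] l h uv by simp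
  qed (use l h in simp)
  ultimately show ?thesis using l unfolding y_def by blast
qed

end

section \<open>Borel measurability of the decoder\<close>

context oligomorphic_borel_action begin

lemma pred_Y: "c \<in> lists \<Omega> \<Longrightarrow> Measurable.pred (borel_of X) (Y k c a)"
  using Y_borel by (simp add: pred_def)

lemma pred_Yn: "Measurable.pred (borel_of X) (Yn n)"
  unfolding Yn_def[abs_def] by (intro pred_Y loc_in)

lemma pred_varies:
  assumes R: "R \<subseteq> \<Omega>"
  shows "Measurable.pred (borel_of X) (varies R n)"
proof -
  obtain k c a where kca: "loc n = (k, c, a)" by (cases "loc n")
  have c: "c \<in> lists \<Omega>" using loc_in(1)[of n] kca by simp
  \<comment> \<open>By equivariance \<open>f\<close> matters only through the tuple to which its
    inverse sends \<open>c\<close>. This replaces a quantifier over \<open>Fix R\<close> by one over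
    a countable set.\<close>
  define D where "D = (\<lambda>f. map (inv\<^bsub>G\<^esub> f) c) ` Fix R"
  have D: "D \<subseteq> lists \<Omega>" using A_map_closed[OF inv_A[OF Fix_A] c] by (auto simp: D_def)
  have cD: "countable D" using D countable_\<Omega> countable_lists countable_subset by blast
  have Yn: "Yn n (\<phi> f y) \<longleftrightarrow> Y k (map (inv\<^bsub>G\<^esub> f) c) a y" if "f \<in> Fix R" "y \<in> topspace X" for f y
    using Y_act[OF Fix_A[OF that(1)] that(2) c] by (simp add: Yn_def kca)
  have pred: "Measurable.pred (borel_of X) (\<lambda>y. (\<exists>d\<in>D. Y k d a y) \<and> (\<exists>d\<in>D. \<not> Y k d a y))"
    using cD D by (intro pred_intros_logic pred_countable_Bex pred_Y) auto
  have "varies R n y \<longleftrightarrow> (\<exists>d\<in>D. Y k d a y) \<and> (\<exists>d\<in>D. \<not> Y k d a y)"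
    if "y \<in> space (borel_of X)" for y
    using that Yn by (auto simp: varies_def D_def)
  from measurable_cong[THEN iffD2, OF this pred] show ?thesis .
qed

lemma measurable_site:
  "R \<subseteq> \<Omega> \<Longrightarrow> site R \<in> borel_of X \<rightarrow>\<^sub>M count_space UNIV"
  unfolding site_def[abs_def] by (intro measurable_Least pred_varies)

lemma measurable_nxt:
  assumes "R \<in> Fpow \<Omega>"
  shows "nxt s R \<in> borel_of X \<rightarrow>\<^sub>M count_space (Fpow \<Omega>)"
proof -
  have "(\<lambda>n. grow s R \<union> support n) \<in> count_space UNIV \<rightarrow>\<^sub>M count_space (Fpow \<Omega>)"
    using assms by (simp add: Fpow_Un grow_Fpow support_Fpow)
  from measurable_compose[OF measurable_site[OF Fpow_subset[OF grow_Fpow[OF assms, of s]]] this]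
  show ?thesis by (simp add: nxt_def[abs_def])
qed

lemma pred_bit_at:
  assumes "R \<in> Fpow \<Omega>"
  shows "Measurable.pred (borel_of X) (bit_at s R)"
  unfolding bit_at_def[abs_def]
  by (rule measurable_compose_countable'[where I = UNIV and f = "\<lambda>n. Yn n"])
    (use pred_Yn measurable_site[OF Fpow_subset[OF grow_Fpow[OF assms]]] in auto)

lemma countable_Fpow_\<Omega>: "countable (Fpow \<Omega>)"
  using countable_\<Omega> countable_Collect_finite_subset[of \<Omega>] by (simp add: Fpow_def conj_commute)

text \<open>The stages take values in the countable set \<open>Fpow \<Omega>\<close>, so
  \<open>nxt\<close> can be treated separately for each value of its set argument.\<close>

lemma measurable_stage: "stage s \<in> borel_of X \<rightarrow>\<^sub>M count_space (Fpow \<Omega>)"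
proof (induction s)
  case 0
  show ?case by (simp add: Fpow_def)
next
  case (Suc s)
  have "(\<lambda>y. nxt s (stage s y) y) \<in> borel_of X \<rightarrow>\<^sub>M count_space (Fpow \<Omega>)"
    by (rule measurable_compose_countable'[OF measurable_nxt Suc countable_Fpow_\<Omega>])
  then show ?case by simp
qed

lemma pred_decoded: "Measurable.pred (borel_of X) (decoded i u v)"
proof -
  have "Measurable.pred (borel_of X) (\<lambda>y. bit_at s (stage s y) y)" for s
    by (rule measurable_compose_countable'[OF pred_bit_at measurable_stage countable_Fpow_\<Omega>])
  then show ?thesis unfolding decoded_def[abs_def]
    by (intro pred_intros_countable pred_intros_logic) simp_all
qed

text \<open>Replaces the quantifier over \<open>A\<close> by countable ones. Finite pieces of the
  decoded relation must come from \<open>A\<close>; this gives totality and injectivity, and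
  membership in \<open>A\<close> because \<open>A\<close> is closed. Surjectivity and uniqueness of
  values are separate conditions.\<close>

lemma legit_iff:
  "legit i y \<longleftrightarrow>
     (\<forall>u\<in>\<Omega>. \<exists>v\<in>\<Omega>. decoded i u v y) \<and>
     (\<forall>u\<in>\<Omega>. \<forall>u'\<in>\<Omega>. \<forall>v\<in>\<Omega>. u \<noteq> u' \<longrightarrow> \<not> (decoded i u v y \<and> decoded i u' v y)) \<and>
     (\<forall>vs\<in>lists \<Omega>. \<exists>us\<in>{map g vs |g. g \<in> A}. \<forall>p\<in>set (zip us vs). decoded i (fst p) (snd p) y)"
  (is "_ \<longleftrightarrow> ?surj \<and> ?sv \<and> ?fin")
proof
  assume "legit i y"
  then obtain f where f: "f \<in> A" "\<And>u v. u \<in> \<Omega> \<Longrightarrow> v \<in> \<Omega> \<Longrightarrow> decoded i u v y \<longleftrightarrow> f v = u"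
    unfolding legit_def by blast
  have ?surj
    using f inv_apply2[OF f(1)] A_closed[OF inv_A[OF f(1)]] by meson
  moreover have ?sv using f by simp
  moreover have ?fin
  proof
    fix vs assume vs: "vs \<in> lists \<Omega>"
    have "decoded i (fst p) (snd p) y" if "p \<in> set (zip (map f vs) vs)" for p
    proof -
      have "snd p \<in> \<Omega>" "fst p = f (snd p)"
        using that vs by (auto simp: set_zip in_lists_conv_set)
      then show ?thesis using f A_closed by simp
    qed
    then show "\<exists>us\<in>{map g vs |g. g \<in> A}. \<forall>p\<in>set (zip us vs). decoded i (fst p) (snd p) y"
      using f(1) by blast
  qed
  ultimately show "?surj \<and> ?sv \<and> ?fin" by blast
next
  assume "?surj \<and> ?sv \<and> ?fin"
  note surj = this[THEN conjunct1] and sv = this[THEN conjunct2, THEN conjunct1]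
    and fin' = this[THEN conjunct2, THEN conjunct2]
  have fin: "\<exists>g\<in>A. \<forall>v\<in>set vs. decoded i (g v) v y" if vs: "vs \<in> lists \<Omega>" for vs
  proof -
    from bspec[OF fin' vs] obtain g where g: "g \<in> A"
        "\<forall>p\<in>set (zip (map g vs) vs). decoded i (fst p) (snd p) y"
      by blast
    have "(g v, v) \<in> set (zip (map g vs) vs)" if "v \<in> set vs" for v
      using that by (simp add: zip_map1 zip_same_conv_map image_iff)
    then show ?thesis using g by fastforce
  qed
  have "\<exists>u\<in>\<Omega>. decoded i u v y" if "v \<in> \<Omega>" for v
    using fin[of "[v]"] that A_closed by auto
  then obtain f' where f': "\<And>v. v \<in> \<Omega> \<Longrightarrow> f' v \<in> \<Omega> \<and> decoded i (f' v) v y" by metis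
  define f where "f = restrict f' \<Omega>"
  have f: "f v \<in> \<Omega>" "decoded i u v y \<longleftrightarrow> f v = u" if "u \<in> \<Omega>" "v \<in> \<Omega>" for u v
    using f'[OF that(2)] sv that by (auto simp: f_def)
  have agree: "\<exists>g\<in>A. map g vs = map f vs" if vs: "vs \<in> lists \<Omega>" for vs
  proof -
    obtain g where g: "g \<in> A" "\<forall>v\<in>set vs. decoded i (g v) v y" using fin[OF vs] by blast
    have "g v = f v" if "v \<in> set vs" for v
      using g f(2)[of "g v" v] that vs A_closed[OF g(1)] by (auto simp: in_lists_conv_set)
    then show ?thesis using g(1) by auto
  qed
  have "inj_on f \<Omega>"
  proof (rule inj_onI)
    fix v w assume vw: "v \<in> \<Omega>" "w \<in> \<Omega>" "f v = f w"
    then obtain g where "g \<in> A" "map g [v, w] = map f [v, w]" using agree[of "[v, w]"] by auto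
    then show "v = w" using vw inv_apply1[of g v] inv_apply1[of g w] by simp
  qed
  moreover have "f ` \<Omega> = \<Omega>"
  proof (intro equalityI subsetI)
    fix u assume u: "u \<in> \<Omega>"
    then obtain v where "v \<in> \<Omega>" "decoded i u v y" using surj by blast
    then show "u \<in> f ` \<Omega>" using f(2)[OF u] by blast
  qed (use f(1) in auto)
  ultimately have "f \<in> Bij \<Omega>" by (simp add: Bij_def bij_betw_def f_def)
  then have "f \<in> A" using agree by (rule closed_A)
  then show "legit i y" using f(2) unfolding legit_def by blast
qed

lemma pred_legit: "Measurable.pred (borel_of X) (legit i)"
proof -
  \<comment> \<open>Even if \<open>A\<close> is uncountable, the images of one tuple form a set of
    tuples over \<open>\<Omega>\<close>.\<close>
  have "countable {map g vs |g. g \<in> A}" if "vs \<in> lists \<Omega>" for vs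
    by (rule countable_subset[OF _ countable_lists[OF countable_\<Omega>]]) (use that A_closed in auto)
  then show ?thesis unfolding legit_iff[abs_def]
    by (intro pred_intros_logic pred_countable_Bex pred_countable_Ball pred_decoded
        countable_\<Omega> countable_lists) (auto intro: countable_finite)
qed

lemma measurable_elem: "elem i \<in> borel_of X \<rightarrow>\<^sub>M borel_of T"
proof (rule measurable_borel_ofI)
  show "elem i y \<in> topspace T" for y using elem_A by simp
  fix U assume U: "openin T U"
  define I where "I = {(c, a) \<in> lists \<Omega> \<times> lists \<Omega>. length c = length a \<and> cyl c a \<subseteq> U}"
  have elem_legit: "decoded i u v y \<longleftrightarrow> elem i y v = u" if "legit i y" "u \<in> \<Omega>" "v \<in> \<Omega>" for y u v
    using that elem_eq unfolding legit_def by metis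
  have I: "elem i y \<in> U \<longleftrightarrow> (\<exists>p\<in>I. elem i y \<in> cyl (fst p) (snd p))" for y
  proof
    assume "elem i y \<in> U"
    then obtain c where "c \<in> lists \<Omega>" "cyl c (map (elem i y) c) \<subseteq> U" using openin_T_cyl[OF U] by blast
    then show "\<exists>p\<in>I. elem i y \<in> cyl (fst p) (snd p)"
      using elem_A A_map_closed[OF elem_A]
      by (intro bexI[of _ "(c, map (elem i y) c)"]) (auto simp: I_def cyl_def)
  qed (auto simp: I_def)
  \<comment> \<open>Membership in a cylinder is a finite conjunction of decoded facts where decoding
    succeeds, and a constant where the default is used.\<close>
  have cyl: "elem i y \<in> cyl c a \<longleftrightarrow>
      legit i y \<and> (\<forall>p\<in>set (zip c a). decoded i (snd p) (fst p) y) \<or>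
      \<not> legit i y \<and> \<one>\<^bsub>G\<^esub> \<in> cyl c a" if "(c, a) \<in> I" for y c a
  proof (cases "legit i y")
    case True
    have ca: "c \<in> lists \<Omega>" "a \<in> lists \<Omega>" "length c = length a" using that by (auto simp: I_def)
    have "elem i y \<in> cyl c a \<longleftrightarrow> (\<forall>j<length c. elem i y (c ! j) = a ! j)"
      using elem_A ca by (auto simp: cyl_def list_eq_iff_nth_eq)
    also have "\<dots> \<longleftrightarrow> (\<forall>j<length c. decoded i (a ! j) (c ! j) y)"
      using elem_legit[OF True] ca by (auto simp: in_lists_conv_set)
    also have "\<dots> \<longleftrightarrow> (\<forall>p\<in>set (zip c a). decoded i (snd p) (fst p) y)"
    proof (intro iffI ballI allI impI)
      fix j assume *: "\<forall>p\<in>set (zip c a). decoded i (snd p) (fst p) y" and j: "j < length c"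
      then have "(c ! j, a ! j) \<in> set (zip c a)" using ca by (auto simp: in_set_zip)
      from bspec[OF * this] show "decoded i (a ! j) (c ! j) y" by simp
    qed (use ca in \<open>auto simp: in_set_zip\<close>)
    finally show ?thesis using True by simp
  next
    case False then show ?thesis by (simp add: elem_def)
  qed
  have "Measurable.pred (borel_of X) (\<lambda>y. \<exists>p\<in>I. elem i y \<in> cyl (fst p) (snd p))"
  proof (intro pred_countable_Bex)
    have "countable (lists \<Omega> \<times> lists \<Omega>)" using countable_\<Omega> by auto
    then show "countable I" by (rule countable_subset[rotated]) (auto simp: I_def)
    fix p assume "p \<in> I"
    then have p: "(fst p, snd p) \<in> I" by simp
    show "Measurable.pred (borel_of X) (\<lambda>y. elem i y \<in> cyl (fst p) (snd p))"
      unfolding cyl[OF p]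
      by (intro pred_intros_logic pred_intros_finite pred_legit pred_decoded) auto
  qed
  then have "{y \<in> space (borel_of X). elem i y \<in> U} \<in> sets (borel_of X)"
    unfolding pred_def I .
  moreover have "{y \<in> space (borel_of X). elem i y \<in> U} = elem i -` U \<inter> space (borel_of X)" by auto
  ultimately show "elem i -` U \<inter> space (borel_of X) \<in> sets (borel_of X)" by simp
qed

section \<open>The Borel graph and its components\<close>

lemma borel_graph_exists:
  "\<exists>E. borel_graph X E \<and> orbit_equivalence_relation G X \<phi> = connectedness_relation X E"
proof -
  let ?XX = "prod_topology X X"
  have mfst: "fst \<in> borel_of ?XX \<rightarrow>\<^sub>M borel_of X" and msnd: "snd \<in> borel_of ?XX \<rightarrow>\<^sub>M borel_of X"
    by (auto intro: continuous_map_measurable continuous_map_fst continuous_map_snd)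
  obtain D where D: "countable D" "D \<subseteq> A" "T closure_of D = A"
    using polish_T unfolding polish_space_def separable_space_def by auto
  have graph: "{p \<in> topspace ?XX. \<phi> (e p) (fst p) = snd p} \<in> sets (borel_of ?XX)"
    if e: "e \<in> borel_of ?XX \<rightarrow>\<^sub>M borel_of T" for e
  proof -
    have "(\<lambda>p. (e p, fst p)) \<in> borel_of ?XX \<rightarrow>\<^sub>M borel_of (prod_topology T X)"
      by (rule measurable_Pair_borel_of[OF second_countable_T second_countable_X e mfst])
    from measurable_compose[OF this measurable_\<phi>]
    have "(\<lambda>p. \<phi> (e p) (fst p)) \<in> borel_of ?XX \<rightarrow>\<^sub>M borel_of X" by simp
    from sets_Collect_eq_borel_of[OF second_countable_X Hausdorff_X this msnd]
    show ?thesis by simp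
  qed
  \<comment> \<open>\<open>K\<close> serves the points with open stabilizer and \<open>J\<close> all
    others. \<open>J i\<close> decodes its element from the second coordinate, the end point of the
    move.\<close>
  define K where "K g = {p \<in> topspace ?XX. \<phi> g (fst p) = snd p}" for g
  define J where "J i = {p \<in> topspace ?XX. \<phi> (elem i (snd p)) (fst p) = snd p}" for i
  define H where "H = (\<Union>g\<in>D. K g) \<union> (J True \<union> J False)"
  define \<Delta> where "\<Delta> = {p \<in> space (borel_of ?XX). fst p = snd p}"
  define E where "E = (H \<union> prod.swap -` H \<inter> space (borel_of ?XX)) - \<Delta>"
  have "K g \<in> sets (borel_of ?XX)" if "g \<in> D" for g
    unfolding K_def using D(2) that by (intro graph continuous_map_measurable) auto
  moreover have "J i \<in> sets (borel_of ?XX)" for i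
    unfolding J_def by (intro graph measurable_compose[OF msnd measurable_elem])
  ultimately have H: "H \<in> sets (borel_of ?XX)"
    unfolding H_def using D(1) by (intro sets.Un sets.countable_UN'')
  have "continuous_map ?XX ?XX prod.swap"
    by (simp add: continuous_map_pairwise o_def continuous_map_fst continuous_map_snd)
  then have "prod.swap -` H \<inter> space (borel_of ?XX) \<in> sets (borel_of ?XX)"
    using H by (intro measurable_sets[OF continuous_map_measurable])
  moreover have "\<Delta> \<in> sets (borel_of ?XX)"
    unfolding \<Delta>_def by (rule sets_Collect_eq_borel_of[OF second_countable_X Hausdorff_X mfst msnd])
  ultimately have "E \<in> sets (borel_of ?XX)"
    unfolding E_def using H by (intro sets.Diff sets.Un)
  moreover have HX: "H \<subseteq> topspace X \<times> topspace X"
    by (auto simp: H_def K_def J_def)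
  then have E_iff: "(x, y) \<in> E \<longleftrightarrow> x \<noteq> y \<and> ((x, y) \<in> H \<or> (y, x) \<in> H)" for x y
    by (auto simp: E_def \<Delta>_def)
  ultimately have "borel_graph X E"
    unfolding borel_graph_def sym_def irrefl_def by blast
  moreover have "orbit_equivalence_relation G X \<phi> = connectedness_relation X E"
  proof (intro equalityI subsetI)
    fix p assume "p \<in> orbit_equivalence_relation G X \<phi>"
    then obtain x h where p: "p = (x, \<phi> h x)" "x \<in> topspace X" "h \<in> A"
      by (auto simp: orbit_equivalence_relation_def orbit_def)
    have hx: "\<phi> h x \<in> topspace X" using p \<phi>_closed by simp
    have step: "(a, b) \<in> E\<^sup>*" "(b, a) \<in> E\<^sup>*" if "(a, b) \<in> H" for a b
      using that E_iff by (cases "a = b"; blast)+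
    have "(x, \<phi> h x) \<in> E\<^sup>*"
    proof (cases "\<exists>R\<in>Fpow \<Omega>. \<forall>f\<in>Fix R. \<phi> f x = x")
      case True
      then obtain R where R: "R \<in> Fpow \<Omega>" "\<And>f. f \<in> Fix R \<Longrightarrow> \<phi> f x = x" by blast
      \<comment> \<open>The cylinder of \<open>h\<close> on a list of \<open>R\<close> is open, so
        it contains some \<open>g\<close> in the dense set. Then \<open>g\<close> and
        \<open>h\<close> agree on \<open>R\<close> and differ by an element that fixes
        \<open>x\<close>.\<close>
      obtain c where c: "set c = R" using R(1) finite_list by (auto simp: Fpow_def)
      then have cl: "c \<in> lists \<Omega>" using R(1) by (auto simp: Fpow_def)
      have "h \<in> cyl c (map h c)" using p by (simp add: cyl_def)
      moreover have "h \<in> T closure_of D" using D(3) p by simp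
      ultimately obtain g where g: "g \<in> D" "g \<in> cyl c (map h c)"
        using openin_cyl[OF cl, of "map h c"] unfolding in_closure_of by blast
      have gA: "g \<in> A" using g D by auto
      have "(inv\<^bsub>G\<^esub> g \<otimes>\<^bsub>G\<^esub> h) r = r" if "r \<in> R" for r
      proof -
        have "r \<in> \<Omega>" "h r = g r" using that c cl g by (auto simp: cyl_def)
        then show ?thesis using gA p inv_apply1 by (simp add: mult_apply)
      qed
      then have "inv\<^bsub>G\<^esub> g \<otimes>\<^bsub>G\<^esub> h \<in> Fix R" using gA p by (simp add: Fix_def)
      then have "\<phi> (inv\<^bsub>G\<^esub> g \<otimes>\<^bsub>G\<^esub> h) x = x" by (rule R(2))
      then have "\<phi> g x = \<phi> g (\<phi> (inv\<^bsub>G\<^esub> g \<otimes>\<^bsub>G\<^esub> h) x)" by simp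
      also have "\<dots> = \<phi> h x"
        using gA p by (simp flip: \<phi>_mult m_assoc)
      finally have "(x, \<phi> h x) \<in> H" using p hx g by (auto simp: H_def K_def)
      then show ?thesis using step by blast
    next
      case False
      \<comment> \<open>\<open>\<phi> g x\<close> is adjacent to \<open>x\<close> by way of
        \<open>g\<close>, and to \<open>\<phi> h x\<close> by way of
        \<open>g \<otimes> inv h\<close>, unless they coincide.\<close>
      then obtain g where g: "g \<in> A" "elem True (\<phi> g x) = g"
          "elem False (\<phi> g x) = g \<otimes>\<^bsub>G\<^esub> inv\<^bsub>G\<^esub> h"
        using common_neighbour[OF p(2) _ p(3)] by blast
      have gx: "\<phi> g x \<in> topspace X" using g p \<phi>_closed by simp
      have "(x, \<phi> g x) \<in> H" using p gx g by (simp add: H_def J_def)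
      moreover have "\<phi> (g \<otimes>\<^bsub>G\<^esub> inv\<^bsub>G\<^esub> h) (\<phi> h x) = \<phi> g x"
        using g(1) p hx by (simp add: \<phi>_mult \<phi>_inv)
      then have "(\<phi> h x, \<phi> g x) \<in> H" using hx gx g by (simp add: H_def J_def)
      ultimately show ?thesis using step by (meson rtrancl_trans)
    qed
    then show "p \<in> connectedness_relation X E" using p hx by (simp add: connectedness_relation_def)
  next
    fix p assume "p \<in> connectedness_relation X E"
    then obtain x y where p: "p = (x, y)" "x \<in> topspace X" "(x, y) \<in> E\<^sup>*"
      by (auto simp: connectedness_relation_def)
    have H_orbit: "\<exists>g\<in>A. \<phi> g a = b" if "(a, b) \<in> H" for a b
      using that D(2) elem_A by (auto simp: H_def K_def J_def)
    have E_orbit: "\<exists>g\<in>A. \<phi> g a = b" if "(a, b) \<in> E" for a b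
    proof -
      from that have "(a, b) \<in> H \<or> (b, a) \<in> H" unfolding E_iff by blast
      then consider "(a, b) \<in> H" | "(b, a) \<in> H" by blast
      then show ?thesis
      proof cases
        case 2
        then obtain g where "g \<in> A" "\<phi> g b = a" using H_orbit by blast
        moreover have "b \<in> topspace X" using 2 HX by blast
        ultimately show ?thesis using \<phi>_inv[of g b] inv_A by metis
      qed (rule H_orbit)
    qed
    have "\<exists>g\<in>A. \<phi> g x = y"
      using p(3)
    proof (induction rule: rtrancl_induct)
      case base then show ?case using \<phi>_one p by (intro bexI[of _ "\<one>\<^bsub>G\<^esub>"]) auto
    next
      case (step y z)
      then obtain g g' where "g \<in> A" "\<phi> g x = y" "g' \<in> A" "\<phi> g' y = z" using E_orbit by metis
      then show ?case using p by (intro bexI[of _ "g' \<otimes>\<^bsub>G\<^esub> g"]) (auto simp: \<phi>_mult)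
    qed
    then show "p \<in> orbit_equivalence_relation G X \<phi>"
      using p by (auto simp: orbit_equivalence_relation_def orbit_def)
  qed
  ultimately show ?thesis by blast
qed

end

subsection \<open>Automorphism groups\<close>

lemma automorphisms_interp:
  assumes "f \<in> automorphisms L M" "r \<in> symbols L" "xs \<in> lists (universe M)" "length xs = arity L r"
  shows "map f xs \<in> interp M r \<longleftrightarrow> xs \<in> interp M r"
  using assms by (simp add: automorphisms_def structure_iso_def)

lemma automorphisms_Bij: "f \<in> automorphisms L M \<Longrightarrow> f \<in> Bij (universe M)"
  by (simp add: automorphisms_def)

lemma automorphismsI:
  assumes "f \<in> Bij (universe M)"
    and "\<And>r xs. r \<in> symbols L \<Longrightarrow> xs \<in> lists (universe M) \<Longrightarrow> length xs = arity L r \<Longrightarrow>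
      map f xs \<in> interp M r \<longleftrightarrow> xs \<in> interp M r"
  shows "f \<in> automorphisms L M"
  using assms by (auto simp: automorphisms_def structure_iso_def Bij_def)

lemma subgroup_automorphisms: "subgroup (automorphisms L M) (BijGroup (universe M))"
proof (rule group.subgroupI[OF group_BijGroup])
  let ?A = "automorphisms L M" and ?\<Omega> = "universe M"
  show "?A \<subseteq> carrier (BijGroup ?\<Omega>)"
    using automorphisms_Bij by (auto simp: BijGroup_def)
  have "(\<lambda>x\<in>?\<Omega>. x) \<in> ?A"
  proof (rule automorphismsI)
    fix r xs assume "xs \<in> lists ?\<Omega>"
    then have "map (\<lambda>x\<in>?\<Omega>. x) xs = xs" by (intro map_idI) auto
    then show "map (\<lambda>x\<in>?\<Omega>. x) xs \<in> interp M r \<longleftrightarrow> xs \<in> interp M r" by simp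
  qed (rule id_Bij)
  then show "?A \<noteq> {}" by auto
  show "inv\<^bsub>BijGroup ?\<Omega>\<^esub> f \<in> ?A" if f: "f \<in> ?A" for f
  proof -
    have B: "f \<in> Bij ?\<Omega>" by (rule automorphisms_Bij[OF f])
    have "(\<lambda>x\<in>?\<Omega>. inv_into ?\<Omega> f x) \<in> ?A"
    proof (rule automorphismsI)
      fix r xs assume r: "r \<in> symbols L" "xs \<in> lists ?\<Omega>" "length xs = arity L r"
      let ?ys = "map (\<lambda>x\<in>?\<Omega>. inv_into ?\<Omega> f x) xs"
      have ys: "?ys \<in> lists ?\<Omega>" using r(2) Bij_inv_into_mem[OF B] by auto
      have "map f ?ys = xs"
        using r(2) B by (auto simp: Bij_def bij_betw_def f_inv_into_f intro!: map_idI)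
      then show "?ys \<in> interp M r \<longleftrightarrow> xs \<in> interp M r"
        using automorphisms_interp[OF f r(1) ys] r(3) by (metis length_map)
    qed (rule restrict_inv_into_Bij[OF B])
    then show ?thesis by (simp add: inv_BijGroup[OF B])
  qed
  show "f \<otimes>\<^bsub>BijGroup ?\<Omega>\<^esub> g \<in> ?A" if f: "f \<in> ?A" and g: "g \<in> ?A" for f g
  proof -
    have B: "f \<in> Bij ?\<Omega>" "g \<in> Bij ?\<Omega>" using f g automorphisms_Bij by auto
    have "compose ?\<Omega> f g \<in> ?A"
    proof (rule automorphismsI)
      fix r xs assume r: "r \<in> symbols L" "xs \<in> lists ?\<Omega>" "length xs = arity L r"
      have gxs: "map g xs \<in> lists ?\<Omega>" using r(2) Bij_imp_funcset[OF B(2)] by (auto simp: Pi_iff)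
      have "map (compose ?\<Omega> f g) xs = map f (map g xs)" using r(2) by (auto simp: compose_eq)
      then show "map (compose ?\<Omega> f g) xs \<in> interp M r \<longleftrightarrow> xs \<in> interp M r"
        using automorphisms_interp[OF f r(1) gxs] automorphisms_interp[OF g r] r(3)
        by (metis length_map)
    qed (rule compose_Bij[OF B])
    then show ?thesis using B by (simp add: BijGroup_def)
  qed
qed

text \<open>Each atomic formula involves only finitely many elements, so agreement with
  automorphisms on tuples suffices.\<close>

lemma automorphisms_closed:
  assumes "f \<in> Bij (universe M)"
    and "\<And>vs. vs \<in> lists (universe M) \<Longrightarrow> \<exists>g\<in>automorphisms L M. map g vs = map f vs"
  shows "f \<in> automorphisms L M"
proof (rule automorphismsI[OF assms(1)])
  fix r xs assume r: "r \<in> symbols L" "xs \<in> lists (universe M)" "length xs = arity L r"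
  then obtain g where "g \<in> automorphisms L M" "map g xs = map f xs" using assms(2) by blast
  then show "map f xs \<in> interp M r \<longleftrightarrow> xs \<in> interp M r" using automorphisms_interp r by metis
qed

text \<open>
  In a finite relational language there are only finitely many quantifier-free types of one
  element over a finite set.
\<close>

lemma ultrahomogeneous_finitely_many_orbits:
  assumes L: "finite (symbols L)" and uh: "ultrahomogeneous L M"
    and R: "finite R" "R \<subseteq> universe M"
  shows "\<exists>S. finite S \<and> S \<subseteq> universe M \<and>
    (\<forall>v\<in>universe M. \<exists>f\<in>automorphisms L M. (\<forall>r\<in>R. f r = r) \<and> f v \<in> S)"
proof -
  let ?\<Omega> = "universe M"
  \<comment> \<open>\<open>K\<close> consists of the atomic formulas in one variable with parameters
    in \<open>R\<close>: \<open>None\<close> is the variable and \<open>Some r\<close> a parameter.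
    \<open>\<theta> v\<close> substitutes \<open>v\<close> for the variable.\<close>
  define K where "K = (SIGMA r:symbols L. {ys. set ys \<subseteq> insert None (Some ` R) \<and> length ys = arity L r})"
  define \<theta> :: "'b \<Rightarrow> 'b option \<Rightarrow> 'b" where "\<theta> v z = (case z of None \<Rightarrow> v | Some r \<Rightarrow> r)" for v z
  \<comment> \<open>The second component records equality with an element of \<open>R\<close>, which
    the relation symbols do not express.\<close>
  define \<tau> where "\<tau> v = ({p \<in> K. map (\<theta> v) (snd p) \<in> interp M (fst p)}, if v \<in> R then Some v else None)" for v
  have K: "finite K"
    unfolding K_def using L R(1) by (intro finite_SigmaI finite_lists_length_eq) auto
  have "\<tau> ` ?\<Omega> \<subseteq> Pow K \<times> insert None (Some ` R)"
    by (auto simp: \<tau>_def)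
  moreover have "finite (Pow K \<times> insert None (Some ` R))" using K R(1) by simp
  ultimately have fin: "finite (\<tau> ` ?\<Omega>)" by (rule finite_subset)
  have move: "\<exists>f\<in>automorphisms L M. (\<forall>r\<in>R. f r = r) \<and> f v = w"
    if vw: "v \<in> ?\<Omega>" "w \<in> ?\<Omega>" "\<tau> v = \<tau> w" for v w
  proof (cases "v \<in> R")
    case True
    then have "w = v" using vw(3) by (auto simp: \<tau>_def split: if_splits)
    moreover have "(\<lambda>x\<in>?\<Omega>. x) \<in> automorphisms L M"
      using subgroup.one_closed[OF subgroup_automorphisms[where L = L and M = M]] by (simp add: BijGroup_def)
    ultimately show ?thesis using R vw by (intro bexI[of _ "\<lambda>x\<in>?\<Omega>. x"]) auto
  next
    case False
    then have w: "w \<notin> R" using vw(3) by (auto simp: \<tau>_def split: if_splits)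
    \<comment> \<open>Extends the identity on \<open>R\<close> by sending \<open>v\<close> to
      \<open>w\<close>. Equality of the types makes it an isomorphism of finite substructures, to
      which ultrahomogeneity applies.\<close>
    define f where "f z = (if z = v then w else z)" for z
    have "f \<in> structure_iso L (substructure M (insert v R)) (substructure M (insert w R))"
      unfolding structure_iso_def
    proof (intro CollectI conjI ballI impI)
      show "bij_betw f (universe (substructure M (insert v R))) (universe (substructure M (insert w R)))"
        using False w by (auto simp: bij_betw_def inj_on_def f_def substructure_def image_iff)
      fix r xs assume r: "r \<in> symbols L" "xs \<in> lists (universe (substructure M (insert v R)))"
        "length xs = arity L r"
      define ys where "ys = map (\<lambda>z. if z = v then None else Some z) xs"
      have xs: "set xs \<subseteq> insert v R" using r(2) by (auto simp: substructure_def)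
      have K: "(r, ys) \<in> K" using r xs by (auto simp: K_def ys_def)
      have "map (\<theta> v) ys = xs" by (auto simp: ys_def \<theta>_def intro!: map_idI)
      moreover have "map (\<theta> w) ys = map f xs" by (auto simp: ys_def \<theta>_def f_def)
      moreover have "map (\<theta> v) ys \<in> interp M r \<longleftrightarrow> map (\<theta> w) ys \<in> interp M r"
      proof -
        have "(r, ys) \<in> fst (\<tau> v) \<longleftrightarrow> (r, ys) \<in> fst (\<tau> w)" using vw(3) by simp
        then show ?thesis using K by (simp add: \<tau>_def)
      qed
      moreover have "xs \<in> lists (insert v R)" "map f xs \<in> lists (insert w R)"
        using xs by (auto simp: f_def)
      ultimately show "xs \<in> interp (substructure M (insert v R)) r \<longleftrightarrow>
          map f xs \<in> interp (substructure M (insert w R)) r"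
        unfolding substructure_def by simp
    qed
    moreover have "finite (insert v R)" "insert v R \<subseteq> ?\<Omega>" "finite (insert w R)" "insert w R \<subseteq> ?\<Omega>"
      using R vw by auto
    ultimately obtain g where g: "g \<in> automorphisms L M" "\<forall>a\<in>insert v R. g a = f a"
      using uh unfolding ultrahomogeneous_def by meson
    moreover have "f r = r" if "r \<in> R" for r using that False by (auto simp: f_def)
    ultimately show ?thesis by (intro bexI[of _ g]) (auto simp: f_def)
  qed
  define \<rho> where "\<rho> t = (SOME v. v \<in> ?\<Omega> \<and> \<tau> v = t)" for t
  have \<rho>: "\<rho> (\<tau> v) \<in> ?\<Omega> \<and> \<tau> (\<rho> (\<tau> v)) = \<tau> v" if "v \<in> ?\<Omega>" for v
    unfolding \<rho>_def by (rule someI[of _ v]) (use that in simp)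
  have "finite (\<rho> ` \<tau> ` ?\<Omega>)" using fin by simp
  moreover have "\<rho> ` \<tau> ` ?\<Omega> \<subseteq> ?\<Omega>" using \<rho> by auto
  moreover have "\<exists>f\<in>automorphisms L M. (\<forall>r\<in>R. f r = r) \<and> f v \<in> \<rho> ` \<tau> ` ?\<Omega>" if v: "v \<in> ?\<Omega>" for v
  proof -
    have "\<rho> (\<tau> v) \<in> ?\<Omega>" "\<tau> v = \<tau> (\<rho> (\<tau> v))" using \<rho>[OF v] by auto
    then obtain f where "f \<in> automorphisms L M" "\<forall>r\<in>R. f r = r" "f v = \<rho> (\<tau> v)"
      using move[OF v] by blast
    then show ?thesis using v by (intro bexI[of _ f]) auto
  qed
  ultimately show ?thesis by (intro exI[of _ "\<rho> ` \<tau> ` ?\<Omega>"]) blast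
qed

section \<open>Transfer along isomorphisms of topological groups\<close>

text \<open>Composition with the inverse isomorphism \<open>\<psi>'\<close> turns an action of
  \<open>\<Gamma>\<close> into one of \<open>\<Delta>\<close> with the same orbits, since
  \<open>\<psi>'\<close> is onto.\<close>

lemma graphic_isomorphic:
  assumes tg: "topological_group \<Gamma> T" and iso: "topological_group_isomorphic \<Gamma> T \<Delta> S"
    and gr: "group \<Delta>" and \<Delta>: "carrier \<Delta> = topspace S" and S: "polish_space S"
    and graph: "\<And>(X :: 'x topology) \<phi>. polish_space X \<Longrightarrow> borel_action \<Delta> S X \<phi> \<Longrightarrow>
      \<exists>E. borel_graph X E \<and> orbit_equivalence_relation \<Delta> X \<phi> = connectedness_relation X E"
  shows "graphic TYPE('x) \<Gamma> T"
proof -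
  obtain \<psi> where \<psi>: "\<psi> \<in> iso \<Gamma> \<Delta>" "homeomorphic_map T S \<psi>"
    using iso unfolding topological_group_isomorphic_def by blast
  have \<Gamma>: "group \<Gamma>" "topspace T = carrier \<Gamma>" using tg by (auto simp: topological_group_def)
  have "T homeomorphic_space S" using \<psi>(2) homeomorphic_map_imp_homeomorphic_space by blast
  then have T: "polish_space T"
    using S homeomorphic_completely_metrizable_space homeomorphic_separable_space
    unfolding polish_space_def by blast
  define \<psi>' where "\<psi>' = inv_into (carrier \<Gamma>) \<psi>"
  have bij: "bij_betw \<psi> (carrier \<Gamma>) (carrier \<Delta>)" using \<psi>(1) by (simp add: iso_def)
  have \<psi>'_hom: "\<psi>' \<in> hom \<Delta> \<Gamma>"
    using group.iso_set_sym[OF \<Gamma>(1) \<psi>(1)] by (simp add: \<psi>'_def iso_def)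
  have \<psi>'_im: "\<psi>' ` carrier \<Delta> = carrier \<Gamma>"
    using bij_betw_inv_into[OF bij] by (simp add: \<psi>'_def bij_betw_def)
  \<comment> \<open>The topological inverse \<open>\<xi>\<close> agrees with the algebraic inverse
    \<open>\<psi>'\<close> on the group, which makes \<open>\<psi>'\<close> continuous.\<close>
  obtain \<xi> where "homeomorphic_maps T S \<psi> \<xi>" using \<psi>(2) homeomorphic_map_maps by blast
  then have \<xi>: "continuous_map S T \<xi>" "\<And>g. g \<in> carrier \<Gamma> \<Longrightarrow> \<xi> (\<psi> g) = g"
    using \<Gamma>(2) by (auto simp: homeomorphic_maps_def)
  have "\<xi> f = \<psi>' f" if f: "f \<in> topspace S" for f
  proof -
    obtain g where "g \<in> carrier \<Gamma>" "f = \<psi> g" using f \<Delta> bij by (auto simp: bij_betw_def)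
    then show ?thesis
      using \<xi>(2) bij by (simp add: \<psi>'_def bij_betw_def inv_into_f_f)
  qed
  then have cont: "continuous_map S T \<psi>'" using \<xi>(1) continuous_map_eq by blast
  have "\<exists>E. borel_graph X E \<and> orbit_equivalence_relation \<Gamma> X \<phi> = connectedness_relation X E"
    if X: "polish_space X" and act: "borel_action \<Gamma> T X \<phi>" for X :: "'x topology" and \<phi>
  proof -
    have hom: "group_hom \<Gamma> (BijGroup (topspace X)) \<phi>"
      and meas: "(\<lambda>(g, x). \<phi> g x) \<in> borel_of (prod_topology T X) \<rightarrow>\<^sub>M borel_of X"
      using act by (auto simp: borel_action_def group_action_def)
    have "\<phi> \<circ> \<psi>' \<in> hom \<Delta> (BijGroup (topspace X))"
      using \<psi>'_hom group_hom.homh[OF hom] by (rule hom_compose)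
    then have "group_action \<Delta> (topspace X) (\<phi> \<circ> \<psi>')"
      using gr group_BijGroup
      by (simp add: group_action_def group_hom_def group_hom_axioms_def)
    moreover have "continuous_map (prod_topology S X) (prod_topology T X) (\<lambda>p. (\<psi>' (fst p), snd p))"
      using continuous_map_compose[OF continuous_map_fst cont]
      by (simp add: continuous_map_pairwise o_def continuous_map_snd)
    from measurable_compose[OF continuous_map_measurable[OF this] meas]
    have "(\<lambda>(g, x). (\<phi> \<circ> \<psi>') g x) \<in> borel_of (prod_topology S X) \<rightarrow>\<^sub>M borel_of X"
      by (simp add: case_prod_beta)
    ultimately have "borel_action \<Delta> S X (\<phi> \<circ> \<psi>')" by (simp add: borel_action_def)
    moreover have "orbit \<Gamma> \<phi> x = orbit \<Delta> (\<phi> \<circ> \<psi>') x" for x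
      unfolding orbit_def \<psi>'_im[symmetric] by auto
    then have "orbit_equivalence_relation \<Gamma> X \<phi> = orbit_equivalence_relation \<Delta> X (\<phi> \<circ> \<psi>')"
      by (simp add: orbit_equivalence_relation_def)
    ultimately show ?thesis using graph[OF X] by metis
  qed
  then show ?thesis using tg T by (simp add: graphic_def polish_group_def)
qed

theorem theorem4p14:
  fixes L :: "'r rel_language"
    and M :: "('r, 'a) rel_structure"
    and \<Gamma> :: "('g, 'm) monoid_scheme"
    and T :: "'g topology"
  assumes "finite (symbols L)"
    and "is_structure L M"
    and "countable (universe M)"
    and "ultrahomogeneous L M"
    and "topological_group \<Gamma> T"
    and "topological_group_isomorphic \<Gamma> T (Aut_group L M) (Aut_topology L M)"
  shows "graphic TYPE('x) \<Gamma> T"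
proof -
  interpret P: closed_perm_group "universe M" "automorphisms L M"
  proof (rule closed_perm_group.intro[OF subgroup_automorphisms assms(3)])
    show "f \<in> automorphisms L M" if "f \<in> Bij (universe M)"
      "\<And>vs. vs \<in> lists (universe M) \<Longrightarrow> \<exists>g\<in>automorphisms L M. map g vs = map f vs" for f
      using that by (rule automorphisms_closed)
  qed
  have G: "Aut_group L M = P.G" by (simp add: Aut_group_def P.G_def)
  have T: "Aut_topology L M = P.T" by (simp add: Aut_topology_def P.T_def)
  show ?thesis
  proof (rule graphic_isomorphic[OF assms(5) assms(6)[unfolded G T] P.group_G])
    fix X :: "'x topology" and \<phi>
    assume X: "polish_space X" and act: "borel_action P.G P.T X \<phi>"
    obtain \<B> where \<B>: "countable \<B>" "\<forall>V\<in>\<B>. openin X V"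
      "\<forall>U x. openin X U \<and> x \<in> U \<longrightarrow> (\<exists>V\<in>\<B>. x \<in> V \<and> V \<subseteq> U)"
      using polish_space_imp_second_countable[OF X] unfolding second_countable_def by blast
    \<comment> \<open>The base may be empty, as for the empty space; inserting the empty set makes
      it safe to enumerate.\<close>
    define W where "W = from_nat_into (insert {} \<B>)"
    interpret oligomorphic_borel_action "universe M" "automorphisms L M" X \<phi> W
    proof unfold_locales
      show "openin X (W k)" for k
        using from_nat_into[of "insert {} \<B>" k] \<B>(2) by (auto simp: W_def)
      show "\<exists>k. x \<in> W k \<and> W k \<subseteq> U" if U: "openin X U" "x \<in> U" for U x
      proof -
        obtain V where V: "V \<in> \<B>" "x \<in> V" "V \<subseteq> U" using \<B>(3) U by meson
        then show ?thesis
          using from_nat_into_surj[of "insert {} \<B>" V] \<B>(1) by (auto simp: W_def)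
      qed
      show "\<exists>S. finite S \<and> S \<subseteq> universe M \<and> (\<forall>v\<in>universe M. \<exists>f\<in>P.Fix R. f v \<in> S)"
        if "R \<in> Fpow (universe M)" for R
        using ultrahomogeneous_finitely_many_orbits[OF assms(1,4), of R] that
        unfolding P.Fix_def Fpow_def by (simp add: Bex_def conj_assoc)
    qed (rule X, rule act)
    show "\<exists>E. borel_graph X E \<and> orbit_equivalence_relation P.G X \<phi> = connectedness_relation X E"
      by (rule borel_graph_exists)
  qed (simp_all add: P.polish_T)
qed

end
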